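(* Let $\phi \in C^1(\mathbb{R}^2,\mathbb{R})$ satisfy the following conditions. (1) $\phi$ is strictly star-shaped: $x\,\frac{\partial \phi}{\partial x}(x,y) + y\,\frac{\partial \phi}{\partial y}(x,y) \neq 0$ for all $(x,y)\neq(0,0)$. (2) There is a bounded set $U\subset\mathbb{R}^2$, with $\sigma := \sup\{\operatorname{dist}((x,y),O) : (x,y)\in U\}$, such that $\phi(x,y)\geq 0$ for all $(x,y)\notin U$, and such that for every $r>\sigma$ the function $\phi$ does not vanish identically on the circle $B_r=\{(x,y) : \operatorname{dist}((x,y),O)=r\}$. (3) $\phi(0,0)<0$. Then the planar system $$\dot x = y, \qquad \dot y = -x - y\,\phi(x,y)$$ has exactly one limit cycle, and this limit cycle attracts every non-constant solution.
   Context: $O=(0,0)$ denotes the origin and $\operatorname{dist}$ the Euclidean distance in $\mathbb{R}^2$. A limit cycle of a planar autonomous system means the orbit (closed curve) of a non-constant periodic solution; periodic solutions with the same orbit determine the same limit cycle. A limit cycle $\Gamma$ attracts a solution $\gamma(t)$ if $\gamma(t)$ is defined for all sufficiently large $t$ and $\operatorname{dist}(\gamma(t),\Gamma)\to 0$ as $t\to+\infty$. *)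

theory Defs
  imports "HOL-Analysis.Analysis"
begin

text \<open>The plane is \<open>real \<times> real\<close>, on which the library's \<open>dist\<close> is the Euclidean distance.\<close>

definition partial_x :: "(real \<times> real \<Rightarrow> real) \<Rightarrow> real \<times> real \<Rightarrow> real" where
  "partial_x f = (\<lambda>(x, y). deriv (\<lambda>s. f (s, y)) x)"

definition partial_y :: "(real \<times> real \<Rightarrow> real) \<Rightarrow> real \<times> real \<Rightarrow> real" where
  "partial_y f = (\<lambda>(x, y). deriv (\<lambda>s. f (x, s)) y)"

text \<open>Since \<open>deriv\<close> is total, existence of the partial derivatives is required separately.\<close>

definition C1_plane :: "(real \<times> real \<Rightarrow> real) \<Rightarrow> bool" where
  "C1_plane f \<longleftrightarrow>
     (\<forall>x y. (\<lambda>s. f (s, y)) differentiable at x \<and> (\<lambda>s. f (x, s)) differentiable at y) \<and>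
     continuous_on UNIV (partial_x f) \<and> continuous_on UNIV (partial_y f)"

definition strictly_star_shaped :: "(real \<times> real \<Rightarrow> real) \<Rightarrow> bool" where
  "strictly_star_shaped f \<longleftrightarrow>
     (\<forall>x y. (x, y) \<noteq> (0, 0) \<longrightarrow> x * partial_x f (x, y) + y * partial_y f (x, y) \<noteq> 0)"

text \<open>A solution of the autonomous system \<open>p' = F p\<close> is a function together with its open
  interval of definition \<open>I\<close>; the values of the function outside \<open>I\<close> play no role.\<close>

definition solution_on ::
    "(real \<times> real \<Rightarrow> real \<times> real) \<Rightarrow> real set \<Rightarrow> (real \<Rightarrow> real \<times> real) \<Rightarrow> bool" where
  "solution_on F I \<gamma> \<longleftrightarrow>
     open I \<and> is_interval I \<and> I \<noteq> {} \<and>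
     (\<forall>t\<in>I. (\<gamma> has_vector_derivative F (\<gamma> t)) (at t))"

definition maximal_solution_on ::
    "(real \<times> real \<Rightarrow> real \<times> real) \<Rightarrow> real set \<Rightarrow> (real \<Rightarrow> real \<times> real) \<Rightarrow> bool" where
  "maximal_solution_on F I \<gamma> \<longleftrightarrow>
     solution_on F I \<gamma> \<and>
     (\<forall>J \<delta>. solution_on F J \<delta> \<and> I \<subseteq> J \<and> (\<forall>t\<in>I. \<delta> t = \<gamma> t) \<longrightarrow> J = I)"

text \<open>A limit cycle is the orbit of a non-constant periodic solution; isolation among the
  periodic orbits is not part of the definition.\<close>

definition limit_cycle :: "(real \<times> real \<Rightarrow> real \<times> real) \<Rightarrow> (real \<times> real) set \<Rightarrow> bool" where
  "limit_cycle F \<Gamma> \<longleftrightarrow>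
     (\<exists>\<gamma> T. solution_on F UNIV \<gamma> \<and> T > 0 \<and> (\<forall>t. \<gamma> (t + T) = \<gamma> t) \<and>
            \<not> \<gamma> constant_on UNIV \<and> \<Gamma> = range \<gamma>)"

definition attracts :: "(real \<times> real) set \<Rightarrow> real set \<Rightarrow> (real \<Rightarrow> real \<times> real) \<Rightarrow> bool" where
  "attracts \<Gamma> I \<gamma> \<longleftrightarrow>
     (\<forall>\<^sub>F t in at_top. t \<in> I) \<and> ((\<lambda>t. infdist (\<gamma> t) \<Gamma>) \<longlongrightarrow> 0) at_top"

definition planar_system :: "(real \<times> real \<Rightarrow> real) \<Rightarrow> real \<times> real \<Rightarrow> real \<times> real" where
  "planar_system \<phi> = (\<lambda>(x, y). (y, - x - y * \<phi> (x, y)))"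

end

theory Submission
  imports Defs
begin

text \<open>
  Let \<open>\<lambda> > 1\<close>. Dilating an orbit by \<open>\<lambda>\<close> gives an orbit of the system with damping
  \<open>\<phi> (p / \<lambda>)\<close>, which is smaller than \<open>\<phi> p\<close> by star-shapedness. A half turn in the lower half-plane
  from \<open>(a, 0)\<close> to \<open>(- b, 0)\<close> is a graph over the \<open>x\<close>-axis, and comparing it with a dilated half
  turn shows that \<open>a\<^sub>2 \<le> \<lambda> a\<^sub>1\<close> implies \<open>b\<^sub>2 < \<lambda> b\<^sub>1\<close>. The symmetry \<open>p \<mapsto> - p\<close> gives the same
  for the upper half-plane, so the return map \<open>P\<close> of the positive \<open>x\<close>-axis is monotone with
  \<open>P (\<lambda> a) < \<lambda> P a\<close>; as orbits stay in an annulus, \<open>P\<close> has exactly one fixed point and all its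
  iterates converge to it. The same comparison squeezes an orbit between dilations of the closed
  orbit, which gives attraction.
\<close>

section \<open>Initial value problems\<close>

text \<open>The term \<open>- x / y\<close> in the slope of an orbit is invariant under dilation.
  Where an orbit touches a dilated orbit, the two slopes therefore differ only by the values of
  \<open>\<phi>\<close> at \<open>p\<close> and at \<open>p / \<lambda>\<close>, and this difference
  has a fixed sign: all crossings go the same way. The obstacle is the \<open>x\<close>-axis, where
  the slopes are infinite; hence the detour through nearby dilation factors. The inequality for
  \<open>P\<close> also does the work of continuity: factors close to 1 control \<open>P\<close>
  from both sides, so continuous dependence on initial values never enters. The annulus comes from
  the energy \<open>x^2 + y^2\<close>, whose derivative is \<open>- 2 * y^2 * \<phi>\<close>: the
  signs of \<open>\<phi>\<close> far out and near the origin exclude escape and collapse. These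
  bounds hold in forward time, so existence and uniqueness are developed forward only, and the
  closed orbit is continued backward by periodicity.\<close>

definition solves ::
    "(real \<times> real \<Rightarrow> real \<times> real) \<Rightarrow> (real \<Rightarrow> real \<times> real) \<Rightarrow> real set \<Rightarrow> bool" where
  "solves F g S \<longleftrightarrow> (\<forall>t\<in>S. (g has_vector_derivative F (g t)) (at t within S))"

lemma solves_subset: "solves F g S \<Longrightarrow> T \<subseteq> S \<Longrightarrow> solves F g T"
  unfolding solves_def by (meson has_vector_derivative_within_subset subsetD)

lemma solves_continuous_on: "solves F g S \<Longrightarrow> continuous_on S g"
  unfolding solves_def continuous_on_eq_continuous_within
  by (meson has_vector_derivative_continuous)

lemma solves_shift: "solves F g S \<Longrightarrow> (\<And>t. t \<in> T \<Longrightarrow> t + c \<in> S) \<Longrightarrow> solves F (\<lambda>t. g (t + c)) T"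
  unfolding solves_def
proof (intro ballI)
  fix t assume S: "\<forall>t\<in>S. (g has_vector_derivative F (g t)) (at t within S)"
    and T: "\<And>t. t \<in> T \<Longrightarrow> t + c \<in> S" and t: "t \<in> T"
  have "((\<lambda>t. t + c) has_vector_derivative 1) (at t within T)"
    by (auto intro!: derivative_eq_intros)
  moreover have "(g has_vector_derivative F (g (t + c))) (at (t + c) within (\<lambda>t. t + c) ` T)"
    by (rule has_vector_derivative_within_subset[OF bspec[OF S T[OF t]]]) (use T in auto)
  ultimately show "((\<lambda>t. g (t + c)) has_vector_derivative F (g (t + c))) (at t within T)"
    using vector_diff_chain_within[of "\<lambda>t. t + c" 1 t T g] by (simp add: o_def)
qed

text \<open>In \<open>solves\<close> the derivative is one-sided at the ends of a closed interval,
  so that pieces of an orbit are again solutions. Inside, the two-sided derivative needed for the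
  mean value theorem is recovered.\<close>

lemma solves_at:
  assumes "solves F g S" "t \<in> interior S"
  shows "(g has_vector_derivative F (g t)) (at t)"
proof -
  have "t \<in> S" using assms(2) interior_subset by blast
  then have "(g has_vector_derivative F (g t)) (at t within S)"
    using assms(1) by (simp add: solves_def)
  then show ?thesis by (simp only: at_within_interior[OF assms(2)])
qed

lemma deriv_nonpos_imp_le:
  fixes u :: "real \<Rightarrow> real"
  assumes "a \<le> b" "continuous_on {a..b} u"
    and "\<And>t. a < t \<Longrightarrow> t < b \<Longrightarrow> \<exists>y. (u has_real_derivative y) (at t) \<and> y \<le> 0"
  shows "u b \<le> u a"
proof (cases "a = b")
  case False
  obtain u' where u': "\<And>t. a < t \<Longrightarrow> t < b \<Longrightarrow> (u has_real_derivative u' t) (at t) \<and> u' t \<le> 0"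
    using assms(3) by metis
  obtain \<xi> where "a < \<xi>" "\<xi> < b" "u b - u a = u' \<xi> * (b - a)"
    using mvt[of a b u "\<lambda>t. (*) (u' t)"] assms(1,2) False u'
    unfolding has_field_derivative_def by (metis antisym_conv2)
  moreover from this have "u' \<xi> * (b - a) \<le> 0"
    using u'[of \<xi>] assms(1) by (intro mult_nonpos_nonneg) auto
  ultimately show ?thesis by linarith
qed auto

text \<open>A global Lipschitz constant is available after composing the field with the projection
  onto a ball, as in \<open>forward_solution\<close>; the iteration then converges on the whole
  half-line without any gluing of local solutions.\<close>

lemma picard_solution:
  fixes F :: "real \<times> real \<Rightarrow> real \<times> real"
  assumes L: "L > 0" and lip: "\<And>p q. norm (F p - F q) \<le> L * norm (p - q)"
  obtains g where "g 0 = p" "solves F g {0..}"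
proof -
  define g where "g = rec_nat (\<lambda>t::real. p) (\<lambda>_ h t. p + integral {0..t} (\<lambda>s. F (h s)))"
  have g0: "g 0 = (\<lambda>t. p)" and gS: "g (Suc n) = (\<lambda>t. p + integral {0..t} (\<lambda>s. F (g n s)))" for n
    by (auto simp: g_def)
  have contF: "continuous_on UNIV F"
    using lip L by (intro lipschitz_on_continuous_on[of L] lipschitz_onI) (auto simp: dist_norm)
  have contFg: "continuous_on {0..T} (\<lambda>s. F (g n s))" if "continuous_on {0..T} (g n)" for n T
    using continuous_on_compose2[OF contF that] by auto
  have contg: "continuous_on {0..T} (g n)" for n T
  proof (induction n)
    case (Suc n)
    have "continuous_on {0..T} (\<lambda>t. integral {0..t} (\<lambda>s. F (g n s)))"
      by (rule indefinite_integral_continuous_1[OF integrable_continuous_real[OF contFg[OF Suc]]])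
    then show ?case unfolding gS by (intro continuous_intros)
  qed (simp add: g0)
  have derg: "(g (Suc n) has_vector_derivative F (g n t)) (at t within {0..T})" if "t \<in> {0..T}" for n t T
    unfolding gS
    using integral_has_vector_derivative[OF contFg[OF contg] that]
    by (auto intro!: derivative_eq_intros)
  \<comment> \<open>Chosen for the base case: the first increment is at most
    \<open>t * norm (F p)\<close>, and \<open>2 * L * t \<le> exp (2 * L * t)\<close>.\<close>
  define B where "B = norm (F p) / (2 * L)"
  have B0: "B \<ge> 0" using L by (auto simp: B_def)
  \<comment> \<open>The weight \<open>exp (2 * L * t)\<close> makes the iteration contract by \<open>1/2\<close> on the whole half-line.\<close>
  have bound: "norm (g (Suc n) t - g n t) \<le> B * (1/2)^n * exp (2*L*t)" if "t \<ge> 0" for n t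
    using that
  proof (induction n arbitrary: t)
    case 0
    have "2 * L * t \<le> exp (2*L*t)" using exp_ge_add_one_self[of "2*L*t"] by linarith
    then have "t \<le> exp (2*L*t) / (2 * L)" using L by (simp add: field_simps)
    then have "t * norm (F p) \<le> (exp (2*L*t) / (2 * L)) * norm (F p)"
      by (rule mult_right_mono) auto
    then show ?case using 0 by (simp add: g0 gS B_def field_simps)
  next
    case (Suc n)
    show ?case
    proof (cases "t = 0")
      case True
      then show ?thesis using B0 by (simp add: gS)
    next
      case False
      let ?f = "\<lambda>t. g (Suc (Suc n)) t - g (Suc n) t"
      let ?b = "\<lambda>t. B * (1/2)^(Suc n) * exp (2*L*t)"
      have "norm (?f t - ?f 0) \<le> ?b t - ?b 0"
      proof (rule differentiable_bound_general[where f'="\<lambda>s. F (g (Suc n) s) - F (g n s)"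
            and \<phi>'="\<lambda>s. L * (B * (1/2)^n * exp (2 * L * s))"])
        show "0 < t" using Suc False by auto
        show "continuous_on {0..t} ?f" by (intro continuous_intros contg)
        show "continuous_on {0..t} ?b" by (intro continuous_intros)
        fix s assume s: "0 < s" "s < t"
        show "(?f has_vector_derivative F (g (Suc n) s) - F (g n s)) (at s)"
          using derg[of s t] s
          by (intro has_vector_derivative_diff) (auto simp: at_within_Icc_at)
        show "(?b has_vector_derivative L * (B * (1/2)^n * exp (2 * L * s))) (at s)"
          unfolding has_real_derivative_iff_has_vector_derivative[symmetric]
          by (auto intro!: derivative_eq_intros)
        have "norm (F (g (Suc n) s) - F (g n s)) \<le> L * norm (g (Suc n) s - g n s)" by (rule lip)
        also have "\<dots> \<le> L * (B * (1/2)^n * exp (2 * L * s))"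
          using Suc.IH[of s] s L by (intro mult_left_mono) auto
        finally show "norm (F (g (Suc n) s) - F (g n s)) \<le> L * (B * (1/2)^n * exp (2 * L * s))" .
      qed
      moreover have "?f 0 = 0" by (simp add: gS)
      moreover have "?b 0 \<ge> 0" using B0 by simp
      ultimately show ?thesis by simp
    qed
  qed
  define G where "G t = p + (\<Sum>n. g (Suc n) t - g n t)" for t
  have unif: "uniform_limit {0..T} g G sequentially" for T
  proof -
    have "uniform_limit {0..T} (\<lambda>n t. \<Sum>i<n. g (Suc i) t - g i t) (\<lambda>t. \<Sum>i. g (Suc i) t - g i t) sequentially"
    proof (rule Weierstrass_m_test)
      fix n t assume "t \<in> {0..T}"
      then show "norm (g (Suc n) t - g n t) \<le> (B * exp (2*L*T)) * (1/2)^n"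
        using bound[of t n] B0 L
        by (intro order_trans[OF bound]) (auto simp: mult_ac intro!: mult_left_mono)
    next
      show "summable (\<lambda>n. (B * exp (2*L*T)) * (1/2)^n)"
        by (intro summable_mult summable_geometric) auto
    qed
    then have "uniform_limit {0..T} (\<lambda>n t. p + (\<Sum>i<n. g (Suc i) t - g i t)) G sequentially"
      unfolding G_def by (intro uniform_limit_intros)
    then show ?thesis
      by (subst (asm) sum_lessThan_telescope) (simp add: g0)
  qed
  have pw: "(\<lambda>n. g n t) \<longlonglongrightarrow> G t" if "t \<ge> 0" for t
    using tendsto_uniform_limitI[OF unif[of t]] that by auto
  have der: "(G has_vector_derivative F (G t)) (at t within {0..T})" if t: "t \<in> {0..T}" for t T
  proof -
    have "\<exists>h. \<forall>x\<in>{0..T}. (\<lambda>n. g (Suc n) x) \<longlonglongrightarrow> h x \<and>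
        (h has_derivative (\<lambda>r. r *\<^sub>R F (G x))) (at x within {0..T})"
    proof (rule has_derivative_sequence)
      show "convex {0..T}" by simp
      show "t \<in> {0..T}" by fact
      show "(\<lambda>n. g (Suc n) t) \<longlonglongrightarrow> G t" using LIMSEQ_Suc[OF pw[of t]] t by simp
      show "(g (Suc n) has_derivative (\<lambda>r. r *\<^sub>R F (g n x))) (at x within {0..T})" if "x \<in> {0..T}" for n x
        using derg[OF that] by (simp add: has_vector_derivative_def)
      fix e :: real assume "e > 0"
      then have "\<forall>\<^sub>F n in sequentially. \<forall>x\<in>{0..T}. dist (g n x) (G x) < e / L"
        using unif[of T] L by (auto simp: uniform_limit_iff)
      then show "\<forall>\<^sub>F n in sequentially. \<forall>x\<in>{0..T}. \<forall>h. norm (h *\<^sub>R F (g n x) - h *\<^sub>R F (G x)) \<le> e * norm h"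
      proof eventually_elim
        case (elim n)
        show ?case
        proof (intro ballI allI)
          fix x h :: real assume "x \<in> {0..T}"
          then have "norm (g n x - G x) \<le> e / L" using elim by (force simp: dist_norm)
          then have "L * norm (g n x - G x) \<le> e" using L by (simp add: field_simps)
          then have "norm (F (g n x) - F (G x)) \<le> e" using lip[of "g n x" "G x"] by linarith
          then show "norm (h *\<^sub>R F (g n x) - h *\<^sub>R F (G x)) \<le> e * norm h"
            by (simp add: scaleR_diff_right[symmetric] mult.commute[of e] mult_left_mono)
        qed
      qed
    qed
    then obtain h where h: "\<forall>x\<in>{0..T}. (\<lambda>n. g (Suc n) x) \<longlonglongrightarrow> h x \<and>
        (h has_derivative (\<lambda>r. r *\<^sub>R F (G x))) (at x within {0..T})" by blast
    \<comment> \<open>Differentiating the limit termwise only yields some limit function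
      \<open>h\<close>; pointwise convergence identifies it with \<open>G\<close>.\<close>
    have "h x = G x" if "x \<in> {0..T}" for x
      using h that LIMSEQ_Suc[OF pw[of x]] by (intro LIMSEQ_unique) auto
    then have "G x = h x" if "x \<in> {0..T}" for x using that by simp
    moreover have "(h has_vector_derivative F (G t)) (at t within {0..T})"
      using h t by (simp add: has_vector_derivative_def)
    ultimately show ?thesis by (rule has_vector_derivative_transform[OF t])
  qed
  have "solves F G {0..}"
    unfolding solves_def
  proof
    fix t :: real assume "t \<in> {0..}"
    then have "(G has_vector_derivative F (G t)) (at t within {0..t+1})" by (intro der) auto
    moreover have "at t within {0..t+1} = at t within {0..}"
      by (rule at_within_nhd[where S="{..<t+1}"]) auto
    ultimately show "(G has_vector_derivative F (G t)) (at t within {0..})" by simp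
  qed
  moreover have "G 0 = p" 
  proof -
    have "g n 0 = p" for n by (cases n) (auto simp: g0 gS)
    then show ?thesis by (simp add: G_def)
  qed
  ultimately show thesis by (intro that)
qed

text \<open>Gronwall's argument: the weight \<open>exp (-(2*L*t))\<close> makes the squared distance
  of the two solutions nonincreasing. The Lipschitz bound is asked for only along the two solutions,
  since the field is merely locally Lipschitz.\<close>

lemma solves_unique:
  assumes "solves F f {a..b}" "solves F g {a..b}" "f a = g a" "a \<le> b"
    and lip: "\<And>t. t \<in> {a..b} \<Longrightarrow> norm (F (f t) - F (g t)) \<le> L * norm (f t - g t)"
  shows "f b = g b"
proof -
  define u where "u t = exp (-(2*L*t)) * (norm (f t - g t))\<^sup>2" for t
  have "u b \<le> u a"
  proof (rule deriv_nonpos_imp_le[where u=u])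
    show "a \<le> b" by fact
    show "continuous_on {a..b} u"
      unfolding u_def using assms(1,2) by (intro continuous_intros solves_continuous_on)
    fix t assume t: "a < t" "t < b"
    then have f': "(f has_vector_derivative F (f t)) (at t)" and g': "(g has_vector_derivative F (g t)) (at t)"
      using solves_at[OF assms(1)] solves_at[OF assms(2)] by auto
    have d: "((\<lambda>t. f t - g t) has_vector_derivative (F (f t) - F (g t))) (at t)"
      by (intro has_vector_derivative_diff f' g')
    have "((\<lambda>t. (f t - g t) \<bullet> (f t - g t)) has_derivative
        (\<lambda>h. (f t - g t) \<bullet> (h *\<^sub>R (F (f t) - F (g t))) + (h *\<^sub>R (F (f t) - F (g t))) \<bullet> (f t - g t))) (at t)"
      using d unfolding has_vector_derivative_def by (intro has_derivative_inner)
    also have "(\<lambda>h. (f t - g t) \<bullet> (h *\<^sub>R (F (f t) - F (g t))) + (h *\<^sub>R (F (f t) - F (g t))) \<bullet> (f t - g t))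
        = (*) (2 * ((f t - g t) \<bullet> (F (f t) - F (g t))))"
      by (rule ext) (simp add: inner_commute[of "F _ - F _"])
    finally have "((\<lambda>t. (f t - g t) \<bullet> (f t - g t)) has_real_derivative 2 * ((f t - g t) \<bullet> (F (f t) - F (g t)))) (at t)"
      by (simp only: has_field_derivative_def)
    moreover have "((\<lambda>t. exp (-(2*L*t))) has_real_derivative -2 * L * exp (-(2*L*t))) (at t)"
      by (auto intro!: derivative_eq_intros)
    ultimately have "(u has_real_derivative
        exp (-(2*L*t)) * (2 * ((f t - g t) \<bullet> (F (f t) - F (g t)))) +
        -2 * L * exp (-(2*L*t)) * ((f t - g t) \<bullet> (f t - g t))) (at t)"
      unfolding u_def power2_norm_eq_inner by (rule DERIV_mult'[rotated])
    then have "(u has_real_derivative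
        exp (-(2*L*t)) * (2 * ((f t - g t) \<bullet> (F (f t) - F (g t))) - 2 * L * (norm (f t - g t))\<^sup>2)) (at t)"
      unfolding power2_norm_eq_inner by (rule DERIV_cong) (simp only: ring_distribs mult_ac diff_conv_add_uminus mult_minus_left mult_minus_right)
    moreover have "(f t - g t) \<bullet> (F (f t) - F (g t)) \<le> norm (f t - g t) * (L * norm (f t - g t))"
      using t by (intro order_trans[OF norm_cauchy_schwarz] mult_left_mono lip) auto
    ultimately show "\<exists>y. (u has_real_derivative y) (at t) \<and> y \<le> 0"
      by (intro exI conjI[rotated]) (auto simp: mult_le_0_iff power2_eq_square mult_ac)
  qed
  then have "u b \<le> 0" using assms(3) by (simp add: u_def)
  then show ?thesis by (simp add: u_def mult_le_0_iff)
qed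

section \<open>Strictly star-shaped damping\<close>

lemma compact_preimage_Icc:
  fixes f :: "real \<Rightarrow> 'a::topological_space"
  assumes "continuous_on {a..b} f" "closed T"
  shows "compact {s\<in>{a..b}. f s \<in> T}"
proof -
  have "closed ({a..b} \<inter> f -` T)"
    using assms by (intro continuous_closed_preimage) auto
  moreover have "{a..b} \<inter> f -` T = {s\<in>{a..b}. f s \<in> T}" by auto
  moreover have "bounded {s\<in>{a..b}. f s \<in> T}"
    by (rule bounded_subset[of "{a..b}"]) auto
  ultimately show ?thesis by (simp add: compact_eq_bounded_closed)
qed

text \<open>After the last time with \<open>E t \<le> m\<close> the function cannot increase. The
  derivative condition is restricted to \<open>E t > m\<close> because the sign of the damping is
  known only outside a large circle or inside a small one.\<close>

lemma stays_below:
  fixes E :: "real \<Rightarrow> real"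
  assumes "a \<le> b" and cont: "continuous_on {a..b} E"
    and der: "\<And>t. a < t \<Longrightarrow> t < b \<Longrightarrow> E t > m \<Longrightarrow> \<exists>y. (E has_real_derivative y) (at t) \<and> y \<le> 0"
    and "E a \<le> m"
  shows "E b \<le> m"
proof (rule ccontr)
  assume neg: "\<not> E b \<le> m"
  define S where "S = {t\<in>{a..b}. E t \<le> m}"
  have "compact S"
    using compact_preimage_Icc[OF cont, of "{..m}"] by (simp add: S_def)
  moreover have "a \<in> S" using assms by (auto simp: S_def)
  ultimately obtain c where c: "c \<in> S" "\<And>t. t \<in> S \<Longrightarrow> t \<le> c"
    using compact_attains_sup[of S] by blast
  have cb: "c \<le> b" "a \<le> c" "E c \<le> m" using c by (auto simp: S_def)
  have "E b \<le> E c"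
  proof (rule deriv_nonpos_imp_le[where u=E])
    show "continuous_on {c..b} E" using cont by (rule continuous_on_subset) (use cb in auto)
    fix t assume t: "c < t" "t < b"
    then have "t \<notin> S" using c(2) by force
    then have "E t > m" using t cb by (auto simp: S_def)
    then show "\<exists>y. (E has_real_derivative y) (at t) \<and> y \<le> 0" using der t cb by auto
  qed (use cb in auto)
  then show False using neg cb by linarith
qed

text \<open>Monotonicity along rays replaces the derivative condition. All assumptions are invariant
  under \<open>p \<mapsto> - p\<close>, so each result about the lower half-plane can be
  instantiated for the upper one.\<close>

locale star_damping =
  fixes \<phi> :: "real \<times> real \<Rightarrow> real" and R \<rho> :: real
  assumes cont: "continuous_on UNIV \<phi>"
    and lip: "\<And>M. \<exists>L>0. \<forall>p\<in>cball 0 M. \<forall>q\<in>cball 0 M. \<bar>\<phi> p - \<phi> q\<bar> \<le> L * norm (p - q)"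
    and ray: "\<And>p s. p \<noteq> 0 \<Longrightarrow> s > 1 \<Longrightarrow> \<phi> p < \<phi> (s *\<^sub>R p)"
    and outer: "\<And>p. norm p \<ge> R \<Longrightarrow> \<phi> p \<ge> 0"
    and inner: "\<And>p. norm p \<le> \<rho> \<Longrightarrow> \<phi> p \<le> 0"
    and R_pos: "R > 0" and \<rho>_pos: "\<rho> > 0"
begin

abbreviation "F \<equiv> planar_system \<phi>"

lemma reflect: "star_damping (\<lambda>p. \<phi> (- p)) R \<rho>"
proof
  show "continuous_on UNIV (\<lambda>p. \<phi> (- p))"
    by (intro continuous_on_compose2[OF cont] continuous_intros) auto
  show "\<exists>L>0. \<forall>p\<in>cball 0 M. \<forall>q\<in>cball 0 M. \<bar>\<phi> (- p) - \<phi> (- q)\<bar> \<le> L * norm (p - q)" for M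
  proof -
    obtain L where L: "L > 0" "\<forall>p\<in>cball 0 M. \<forall>q\<in>cball 0 M. \<bar>\<phi> p - \<phi> q\<bar> \<le> L * norm (p - q)"
      using lip by blast
    have "\<bar>\<phi> (- p) - \<phi> (- q)\<bar> \<le> L * norm (p - q)" if "p \<in> cball 0 M" "q \<in> cball 0 M" for p q
    proof -
      have "-p \<in> cball 0 M" "-q \<in> cball 0 M" using that by auto
      then have "\<bar>\<phi> (- p) - \<phi> (- q)\<bar> \<le> L * norm (- p - - q)" using L by blast
      then show ?thesis by (simp add: norm_minus_commute)
    qed
    then show ?thesis using L(1) by blast
  qed
  show "\<phi> (- p) < \<phi> (- (s *\<^sub>R p))" if "p \<noteq> 0" "s > 1" for p s
    using ray[of "-p" s] that by simp
qed (use outer inner R_pos \<rho>_pos in simp_all)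

lemma planar_reflect: "planar_system (\<lambda>p. \<phi> (- p)) (- p) = - F p"
  by (cases p) (simp add: planar_system_def)

lemma solves_reflect:
  assumes "solves F g S"
  shows "solves (planar_system (\<lambda>p. \<phi> (- p))) (\<lambda>t. - g t) S"
  using assms unfolding solves_def planar_reflect by (intro ballI has_vector_derivative_minus) (erule bspec)

lemma solves_fst:
  assumes "solves F g S" "t \<in> S"
  shows "((\<lambda>t. fst (g t)) has_real_derivative snd (g t)) (at t within S)"
proof -
  have "fst (F (g t)) = snd (g t)" by (simp add: planar_system_def split_beta)
  then show ?thesis
    using bounded_linear.has_vector_derivative[OF bounded_linear_fst bspec[OF assms(1)[unfolded solves_def] assms(2)]]
    by (simp only: has_real_derivative_iff_has_vector_derivative)
qed

lemma solves_snd: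
  assumes "solves F g S" "t \<in> S"
  shows "((\<lambda>t. snd (g t)) has_real_derivative - fst (g t) - snd (g t) * \<phi> (g t)) (at t within S)"
proof -
  have "snd (F (g t)) = - fst (g t) - snd (g t) * \<phi> (g t)"
    by (simp add: planar_system_def split_beta)
  then show ?thesis
    using bounded_linear.has_vector_derivative[OF bounded_linear_snd bspec[OF assms(1)[unfolded solves_def] assms(2)]]
    by (simp only: has_real_derivative_iff_has_vector_derivative)
qed

section \<open>Energy estimates: forward orbits are bounded and stay away from the origin\<close>

lemma norm_sq: "(norm p)\<^sup>2 = (fst p)\<^sup>2 + (snd p)\<^sup>2" for p :: "real \<times> real"
  by (cases p) (simp add: norm_Pair)

lemma solves_energy:
  assumes "solves F g S" "t \<in> S"
  shows "((\<lambda>t. (norm (g t))\<^sup>2) has_real_derivative - 2 * (snd (g t))\<^sup>2 * \<phi> (g t)) (at t within S)"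
proof -
  have "((\<lambda>t. (fst (g t))\<^sup>2 + (snd (g t))\<^sup>2) has_real_derivative
      2 * fst (g t) * snd (g t) + 2 * snd (g t) * (- fst (g t) - snd (g t) * \<phi> (g t))) (at t within S)"
    by (rule derivative_eq_intros solves_fst[OF assms] solves_snd[OF assms] refl)+ simp
  then show ?thesis
    unfolding norm_sq by (rule DERIV_cong) (simp add: algebra_simps power2_eq_square)
qed

lemma norm_upper:
  assumes g: "solves F g {a..b}" and "a \<le> b"
  shows "norm (g b) \<le> max (norm (g a)) R"
proof -
  let ?m = "max (norm (g a)) R"
  have "(norm (g b))\<^sup>2 \<le> ?m\<^sup>2"
  proof (rule stays_below[where E="\<lambda>t. (norm (g t))\<^sup>2" and a=a])
    show "continuous_on {a..b} (\<lambda>t. (norm (g t))\<^sup>2)"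
      by (intro continuous_intros solves_continuous_on[OF g])
  next
    fix t assume t: "a < t" "t < b" "?m\<^sup>2 < (norm (g t))\<^sup>2"
    then have "?m < norm (g t)" using power2_less_imp_less by force
    then have "\<phi> (g t) \<ge> 0" by (intro outer) auto
    then show "\<exists>y. ((\<lambda>t. (norm (g t))\<^sup>2) has_real_derivative y) (at t) \<and> y \<le> 0"
      using solves_energy[OF g, of t] t by (auto simp: at_within_Icc_at)
  next
    show "(norm (g a))\<^sup>2 \<le> ?m\<^sup>2" by (rule power_mono) auto
  qed fact
  then show ?thesis by (rule power2_le_imp_le) (use R_pos in auto)
qed

lemma norm_lower:
  assumes g: "solves F g {a..b}" and "a \<le> b"
  shows "norm (g b) \<ge> min (norm (g a)) \<rho>"
proof -
  let ?m = "min (norm (g a)) \<rho>"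
  have m0: "?m \<ge> 0" using \<rho>_pos by simp
  have "- (norm (g b))\<^sup>2 \<le> - ?m\<^sup>2"
  proof (rule stays_below[where E="\<lambda>t. - (norm (g t))\<^sup>2" and a=a])
    show "continuous_on {a..b} (\<lambda>t. - (norm (g t))\<^sup>2)"
      by (intro continuous_intros solves_continuous_on[OF g])
  next
    fix t assume t: "a < t" "t < b" "- ?m\<^sup>2 < - (norm (g t))\<^sup>2"
    then have "norm (g t) < ?m" using power2_less_imp_less[of "norm (g t)" ?m] m0 by force
    then have "\<phi> (g t) \<le> 0" by (intro inner) auto
    then show "\<exists>y. ((\<lambda>t. - (norm (g t))\<^sup>2) has_real_derivative y) (at t) \<and> y \<le> 0"
      using DERIV_minus[OF solves_energy[OF g, of t]] t
      by (auto simp: at_within_Icc_at mult_nonneg_nonpos)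
  next
    have "?m\<^sup>2 \<le> (norm (g a))\<^sup>2" using m0 by (intro power_mono) auto
    then show "- (norm (g a))\<^sup>2 \<le> - ?m\<^sup>2" by (simp only: neg_le_iff_le)
  qed fact
  then have "?m\<^sup>2 \<le> (norm (g b))\<^sup>2" by linarith
  then show ?thesis by (rule power2_le_imp_le) auto
qed

section \<open>Local Lipschitz bounds, forward uniqueness and global forward existence\<close>

lemma field_lipschitz:
  "\<exists>L>0. \<forall>p\<in>cball 0 M. \<forall>q\<in>cball 0 M. norm (F p - F q) \<le> L * norm (p - q)"
proof (cases "M \<ge> 0")
  case True
  obtain L where L: "L > 0" and l: "\<And>p q. p\<in>cball 0 M \<Longrightarrow> q\<in>cball 0 M \<Longrightarrow> \<bar>\<phi> p - \<phi> q\<bar> \<le> L * norm (p - q)"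
    using lip by blast
  \<comment> \<open>The summand 2 pays for the two linear terms, the bracket is a bound of
    \<open>\<phi>\<close> on the ball, and \<open>M * L\<close> bounds \<open>snd q\<close> times
    the Lipschitz constant of \<open>\<phi>\<close>.\<close>
  define K where "K = 2 + (\<bar>\<phi> 0\<bar> + L * M) + M * L"
  have "norm (F p - F q) \<le> K * norm (p - q)" if p: "p \<in> cball 0 M" and q: "q \<in> cball 0 M" for p q
  proof -
    have np: "norm p \<le> M" "norm q \<le> M" using p q by auto
    have "\<bar>\<phi> p - \<phi> 0\<bar> \<le> L * norm p" using l[OF p, of 0] True by simp
    also have "\<dots> \<le> L * M" using np L by (intro mult_left_mono) auto
    finally have bp: "\<bar>\<phi> p\<bar> \<le> \<bar>\<phi> 0\<bar> + L * M" by linarith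
    have y: "\<bar>snd p - snd q\<bar> \<le> norm (p - q)" and x: "\<bar>fst p - fst q\<bar> \<le> norm (p - q)"
      using norm_snd_le[of "snd (p - q)" "fst (p - q)"] norm_fst_le[of "fst (p - q)" "snd (p - q)"]
      unfolding prod.collapse by simp_all
    have sq: "\<bar>snd q\<bar> \<le> M" using norm_snd_le[of "snd q" "fst q"] np unfolding prod.collapse by simp
    have "\<bar>snd p * \<phi> p - snd q * \<phi> q\<bar> = \<bar>(snd p - snd q) * \<phi> p + snd q * (\<phi> p - \<phi> q)\<bar>"
      by (simp add: algebra_simps)
    also have "\<dots> \<le> \<bar>snd p - snd q\<bar> * \<bar>\<phi> p\<bar> + \<bar>snd q\<bar> * \<bar>\<phi> p - \<phi> q\<bar>"
      by (metis abs_mult abs_triangle_ineq)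
    also have "\<dots> \<le> norm (p - q) * (\<bar>\<phi> 0\<bar> + L * M) + M * (L * norm (p - q))"
      using y bp sq l[OF p q] True by (intro add_mono mult_mono) auto
    finally have z: "\<bar>snd p * \<phi> p - snd q * \<phi> q\<bar> \<le> norm (p - q) * (\<bar>\<phi> 0\<bar> + L * M) + M * (L * norm (p - q))" .
    have "norm (F p - F q) = norm (snd p - snd q, - (fst p - fst q) - (snd p * \<phi> p - snd q * \<phi> q))"
      by (simp add: planar_system_def split_beta algebra_simps)
    also have "\<dots> \<le> \<bar>snd p - snd q\<bar> + \<bar>- (fst p - fst q) - (snd p * \<phi> p - snd q * \<phi> q)\<bar>"
      using norm_Pair_le[of "snd p - snd q"] by (metis real_norm_def)
    also have "\<dots> \<le> norm (p - q) + (norm (p - q) + (norm (p - q) * (\<bar>\<phi> 0\<bar> + L * M) + M * (L * norm (p - q))))"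
      using x y z by linarith
    also have "\<dots> = K * norm (p - q)" by (simp add: K_def algebra_simps)
    finally show ?thesis .
  qed
  moreover have "K > 0" using mult_nonneg_nonneg[of L M] L True abs_ge_zero[of "\<phi> 0"] unfolding K_def mult.commute[of M L] by linarith
  ultimately show ?thesis by blast
qed (auto intro!: exI[of _ 1])

text \<open>From \<open>a\<close> on, both solutions remain in one ball fixed by their common
  initial value, so a single local Lipschitz constant serves for the whole interval.\<close>

lemma solves_unique_forward:
  assumes f: "solves F f {a..b}" and g: "solves F g {a..b}" and "f a = g a" "a \<le> b"
  shows "f b = g b"
proof -
  let ?M = "max (norm (f a)) R"
  have bf: "f t \<in> cball 0 ?M" if "t \<in> {a..b}" for t
    using norm_upper[OF solves_subset[OF f], of a t] that by auto
  have bg: "g t \<in> cball 0 ?M" if "t \<in> {a..b}" for t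
    using norm_upper[OF solves_subset[OF g], of a t] that assms(3) by auto
  obtain L where "\<forall>p\<in>cball 0 ?M. \<forall>q\<in>cball 0 ?M. norm (F p - F q) \<le> L * norm (p - q)"
    using field_lipschitz by blast
  then show ?thesis
    using bf bg by (intro solves_unique[OF f g assms(3,4), of L]) blast
qed

text \<open>Projecting onto a ball before applying \<open>F\<close> gives a globally Lipschitz
  field. Its solution never leaves the ball, where both fields agree.\<close>

lemma forward_solution:
  obtains g where "g 0 = p" "solves F g {0..}"
proof -
  define m where "m = max (norm p) R"
  \<comment> \<open>The slack of 1 closes the argument: until the norm first reaches
    \<open>M\<close> the curve solves the original system, so the energy bound keeps its norm at
    most \<open>m < M\<close>.\<close>
  define M where "M = m + 1"
  define C where "C = cball (0 :: real \<times> real) M"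
  have M0: "M > 0" "m > 0" using R_pos by (auto simp: M_def m_def)
  have C: "convex C" "closed C" "C \<noteq> {}" using M0 by (auto simp: C_def)
  obtain L where L: "L > 0" "\<And>p q. p \<in> C \<Longrightarrow> q \<in> C \<Longrightarrow> norm (F p - F q) \<le> L * norm (p - q)"
    using field_lipschitz[of M] unfolding C_def by blast
  define G where "G = (\<lambda>p. F (closest_point C p))"
  have "norm (G p - G q) \<le> L * norm (p - q)" for p q
  proof -
    have "norm (G p - G q) \<le> L * norm (closest_point C p - closest_point C q)"
      unfolding G_def by (intro L closest_point_in_set C)
    also have "\<dots> \<le> L * norm (p - q)"
      using closest_point_lipschitz[OF C, of p q] L(1) by (simp add: dist_norm)
    finally show ?thesis .
  qed
  then obtain g where g: "g 0 = p" "solves G g {0..}"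
    using picard_solution[OF L(1), of G p] by blast
  have solF: "solves F g {0..t}" if "\<And>s. s \<in> {0..t} \<Longrightarrow> norm (g s) \<le> M" for t
    unfolding solves_def
  proof
    fix s assume s: "s \<in> {0..t}"
    then have "G (g s) = F (g s)" using that[OF s] by (simp add: G_def C_def closest_point_self)
    moreover have "solves G g {0..t}" by (rule solves_subset[OF g(2)]) auto
    ultimately show "(g has_vector_derivative F (g s)) (at s within {0..t})"
      using s unfolding solves_def by metis
  qed
  have bound: "norm (g t) \<le> M" if t: "t \<ge> 0" for t
  proof (rule ccontr)
    assume neg: "\<not> norm (g t) \<le> M"
    define S where "S = {s\<in>{0..t}. norm (g s) \<ge> M}"
    have cg: "continuous_on {0..t} (\<lambda>s. norm (g s))"
      using solves_continuous_on[OF g(2)] by (intro continuous_intros) (auto elim: continuous_on_subset)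
    have "compact S"
      using compact_preimage_Icc[OF cg, of "{M..}"] by (simp add: S_def)
    moreover have "t \<in> S" using neg t by (auto simp: S_def)
    ultimately obtain c where c: "c \<in> S" "\<And>s. s \<in> S \<Longrightarrow> c \<le> s"
      using compact_attains_inf[of S] by blast
    have c0: "0 \<le> c" "c \<le> t" "M \<le> norm (g c)" using c by (auto simp: S_def)
    have less: "norm (g s) < M" if "0 \<le> s" "s < c" for s
      using c(2)[of s] that c0 by (force simp: S_def)
    \<comment> \<open>At the first exit time the norm is exactly \<open>M\<close>, so the original
      system is solved on the closed interval up to \<open>c\<close>.\<close>
    have "norm (g c) \<le> M"
    proof (rule ccontr)
      assume "\<not> norm (g c) \<le> M"
      moreover have "norm (g 0) \<le> M" by (simp add: g(1) M_def m_def)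
      ultimately obtain s where "0 \<le> s" "s \<le> c" "norm (g s) = M"
        using IVT'[of "\<lambda>s. norm (g s)" 0 M c] c0 continuous_on_subset[OF cg, of "{0..c}"] by auto
      with less[of s] \<open>\<not> norm (g c) \<le> M\<close> show False by (cases "s = c") auto
    qed
    then have "solves F g {0..c}" using less by (intro solF) (metis atLeastAtMost_iff le_less order.order_iff_strict)
    then have "norm (g c) \<le> m" using norm_upper[of g 0 c] c0 g(1) by (simp add: m_def)
    then show False using c0 by (simp add: M_def)
  qed
  have "solves F g {0..}"
    unfolding solves_def
  proof
    fix s :: real assume s: "s \<in> {0..}"
    have "G (g s) = F (g s)" using bound[of s] s by (simp add: G_def C_def closest_point_self)
    then show "(g has_vector_derivative F (g s)) (at s within {0..})"
      using g(2) s unfolding solves_def by metis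
  qed
  then show thesis using g(1) by (rule that[rotated])
qed

end

section \<open>Oscillation and half turns\<close>

text \<open>The graph of \<open>w\<close> is a half turn in the lower half-plane from \<open>(a, 0)\<close> to \<open>(- b, 0)\<close>,
  parametrised by \<open>x\<close>; the slope is \<open>y' / x'\<close>.\<close>

definition arc :: "(real \<times> real \<Rightarrow> real) \<Rightarrow> real \<Rightarrow> real \<Rightarrow> (real \<Rightarrow> real) \<Rightarrow> bool" where
  "arc \<phi> a b w \<longleftrightarrow> 0 < a \<and> 0 < b \<and> continuous_on {-b..a} w \<and> w a = 0 \<and> w (-b) = 0 \<and>
     (\<forall>x\<in>{-b<..<a}. w x < 0 \<and> (w has_real_derivative - x / w x - \<phi> (x, w x)) (at x))"

context star_damping
begin

lemma orbit_bounds: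
  assumes g: "solves F g {0..}" and "g 0 \<noteq> 0"
  obtains m M where "0 < m" "\<And>t. t \<ge> 0 \<Longrightarrow> m \<le> norm (g t)" "\<And>t. t \<ge> 0 \<Longrightarrow> norm (g t) \<le> M"
proof
  show "0 < min (norm (g 0)) \<rho>" using assms \<rho>_pos by simp
  have s: "solves F g {0..t}" for t by (rule solves_subset[OF g]) auto
  show "min (norm (g 0)) \<rho> \<le> norm (g t)" "norm (g t) \<le> max (norm (g 0)) R" if "t \<ge> 0" for t
    using norm_lower[OF s that] norm_upper[OF s that] .
qed

lemma solves_derivs:
  assumes g: "solves F g {0..}" and t: "t > 0"
  shows "((\<lambda>t. fst (g t)) has_real_derivative snd (g t)) (at t)"
    "((\<lambda>t. snd (g t)) has_real_derivative - fst (g t) - snd (g t) * \<phi> (g t)) (at t)"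
  using solves_fst[OF g, of t] solves_snd[OF g, of t] t
  by (simp_all add: at_within_interior[of t "{0..}"])

text \<open>Otherwise \<open>x\<close> is eventually decreasing, hence convergent to some \<open>l\<close>; boundedness of \<open>y'\<close> then
  forces \<open>y\<close> to tend to \<open>0\<close> (Barbalat), the second equation gives \<open>l = 0\<close>, and the orbit would
  approach the origin.\<close>

lemma not_eventually_below:
  assumes g: "solves F g {0..}" and g0: "g 0 \<noteq> 0" and t0: "t0 \<ge> 0"
  shows "\<exists>t>t0. snd (g t) \<ge> 0"
proof (rule ccontr)
  assume "\<not> ?thesis"
  then have neg: "snd (g t) < 0" if "t > t0" for t using that by force
  define x where "x = (\<lambda>t. fst (g t))"
  define y where "y = (\<lambda>t. snd (g t))"
  have neg: "y t < 0" if "t > t0" for t using neg[OF that] by (simp add: y_def)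
  have dx: "(x has_real_derivative y t) (at t)" if "t > 0" for t
    using solves_derivs(1)[OF g that] by (simp add: x_def y_def)
  have dy: "(y has_real_derivative - x t - y t * \<phi> (g t)) (at t)" if "t > 0" for t
    using solves_derivs(2)[OF g that] by (simp add: x_def y_def)
  obtain m M where m: "0 < m" and mn: "\<And>t. t \<ge> 0 \<Longrightarrow> m \<le> norm (g t)" and Mn: "\<And>t. t \<ge> 0 \<Longrightarrow> norm (g t) \<le> M"
    using orbit_bounds[OF g g0] by blast
  have M0: "M > 0" using m mn[of 0] Mn[of 0] by simp
  have xy: "\<bar>x t\<bar> \<le> norm (g t)" "\<bar>y t\<bar> \<le> norm (g t)" "norm (g t) \<le> \<bar>x t\<bar> + \<bar>y t\<bar>" for t
    using norm_fst_le[of "fst (g t)" "snd (g t)"] norm_snd_le[of "snd (g t)" "fst (g t)"]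
      norm_Pair_le[of "fst (g t)" "snd (g t)"]
    unfolding prod.collapse by (simp_all add: x_def y_def)
  obtain B where B: "B > 0" and \<phi>B: "\<And>t. t \<ge> 0 \<Longrightarrow> \<bar>\<phi> (g t)\<bar> \<le> B"
  proof -
    have "compact (\<phi> ` cball 0 M)"
      by (intro compact_continuous_image continuous_on_subset[OF cont]) auto
    then obtain B where "B > 0" "\<And>p. p \<in> cball 0 M \<Longrightarrow> \<bar>\<phi> p\<bar> \<le> B"
      using bounded_pos[of "\<phi> ` cball 0 M"] compact_imp_bounded by (metis image_eqI real_norm_def)
    then show thesis using Mn by (intro that[of B]) auto
  qed
  define C where "C = M + M * B"
  have C: "C > 0" using M0 B by (simp add: C_def add_pos_pos)
  have mvt1: "\<exists>z>s. z < t \<and> f t - f s = (t - s) * f' z"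
    if "0 < s" "s < t" "\<And>z. 0 < z \<Longrightarrow> (f has_real_derivative f' z) (at z)" for f f' :: "real \<Rightarrow> real" and s t
    using MVT2[of s t f f'] that by fastforce
  have y'C: "\<bar>- x t - y t * \<phi> (g t)\<bar> \<le> C" if "t \<ge> 0" for t
  proof -
    have "\<bar>y t * \<phi> (g t)\<bar> \<le> M * B"
      unfolding abs_mult using xy(2)[of t] Mn[OF that] \<phi>B[OF that] M0 by (intro mult_mono) auto
    then show ?thesis using xy(1)[of t] Mn[OF that] unfolding C_def by linarith
  qed
  have dec: "x t \<le> x s" if st: "t0 < s" "s \<le> t" for s t
  proof (rule DERIV_nonpos_imp_nonincreasing[OF st(2)])
    fix z assume "s \<le> z" "z \<le> t"
    then have "z > 0" "y z \<le> 0" using st t0 neg[of z] by auto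
    then show "\<exists>k. (x has_real_derivative k) (at z) \<and> k \<le> 0" using dx by blast
  qed
  define l where "l = Inf (x ` {t0<..})"
  have "bdd_below (x ` {t0<..})"
    using xy(1) Mn t0 by (intro bdd_belowI2[of _ "-M"]) (smt (verit) greaterThan_iff)
  then have lx: "l \<le> x t" if "t > t0" for t
    unfolding l_def using that by (intro cINF_lower) auto
  have xl: "\<exists>N>t0. \<forall>t\<ge>N. l \<le> x t \<and> x t < l + e" if "e > 0" for e
  proof -
    have "\<exists>N>t0. x N < l + e"
    proof (rule ccontr)
      assume "\<not> ?thesis"
      then have "l + e \<le> x N" if "N > t0" for N using that by force
      then have "l + e \<le> Inf (x ` {t0<..})" by (intro cINF_greatest) auto
      then show False using that by (simp add: l_def)
    qed
    then show ?thesis using dec lx by (meson le_less_trans less_le_trans)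
  qed
  have yl: "\<exists>N>t0. \<forall>t\<ge>N. - e < y t" if e: "e > 0" for e
  proof -
    \<comment> \<open>Since the slope of \<open>y\<close> is at most \<open>C\<close> in absolute
      value, \<open>y t \<le> - e\<close> forces \<open>y \<le> - e / 2\<close> for a time
      \<open>d\<close>, during which \<open>x\<close> falls by \<open>d * (e / 2)\<close>: more than
      its remaining distance to \<open>l\<close>.\<close>
    define d where "d = e / (2 * C)"
    have d: "d > 0" "C * d = e / 2" using e C by (auto simp: d_def)
    obtain N where N: "N > t0" "\<And>t. t \<ge> N \<Longrightarrow> l \<le> x t \<and> x t < l + d * (e / 2)"
      using xl[of "d * (e / 2)"] e d by auto
    have "- e < y t" if t: "t \<ge> N" for t
    proof (rule ccontr)
      assume "\<not> - e < y t"
      then have yt: "y t \<le> - e" by simp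
      have t': "t > 0" using t N(1) t0 by linarith
      have ys: "y s \<le> - e / 2" if s: "t < s" "s < t + d" for s
      proof -
        obtain z where z: "t < z" "y s - y t = (s - t) * (- x z - y z * \<phi> (g z))"
          using mvt1[of t s y "\<lambda>z. - x z - y z * \<phi> (g z)"] dy s t' by blast
        have "(s - t) * (- x z - y z * \<phi> (g z)) \<le> (s - t) * C"
          using s y'C[of z] z(1) t' by (intro mult_left_mono) auto
        also have "\<dots> \<le> d * C" using s C by (intro mult_right_mono) auto
        finally have "(s - t) * (- x z - y z * \<phi> (g z)) \<le> d * C" .
        then show ?thesis using z yt d by (simp add: mult.commute)
      qed
      obtain z where z: "t < z" "z < t + d" "x (t + d) - x t = (t + d - t) * y z"
        using mvt1[of t "t + d" x y] dx d t' by auto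
      have "d * y z \<le> d * (- e / 2)" using ys[OF z(1,2)] d by (intro mult_left_mono) auto
      then have "x (t + d) \<le> x t - d * (e / 2)" using z(3) by simp
      then show False using N(2)[of t] N(2)[of "t + d"] t d by fastforce
    qed
    then show ?thesis using N(1) by blast
  qed
  have "l = 0"
  proof (rule ccontr)
    assume l: "l \<noteq> 0"
    \<comment> \<open>Late on, \<open>\<bar>x\<bar>\<close> is at least \<open>3/4\<close> of
      \<open>\<bar>l\<bar>\<close> and the damping term at most \<open>1/4\<close> of it, so
      \<open>y\<close> has slope at least \<open>\<bar>l\<bar> / 2\<close> in absolute value; yet
      over unit time \<open>y\<close> changes by less than \<open>e\<close>.\<close>
    define e where "e = min (\<bar>l\<bar> / (4 * B)) (\<bar>l\<bar> / 4)"
    have e: "e > 0" "e * B \<le> \<bar>l\<bar> / 4" "e \<le> \<bar>l\<bar> / 4"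
      using l B by (auto simp: e_def min_mult_distrib_right)
    obtain N1 where N1: "N1 > t0" "\<And>t. t \<ge> N1 \<Longrightarrow> l \<le> x t \<and> x t < l + \<bar>l\<bar> / 4"
      using xl[of "\<bar>l\<bar> / 4"] l by auto
    obtain N2 where N2: "N2 > t0" "\<And>t. t \<ge> N2 \<Longrightarrow> - e < y t" using yl[OF e(1)] by auto
    define N where "N = max N1 N2"
    have N: "N > 0" "N \<ge> N1" "N \<ge> N2" using N1(1) t0 by (auto simp: N_def)
    obtain z where z: "N < z" "y (N + 1) - y N = (N + 1 - N) * (- x z - y z * \<phi> (g z))"
      using mvt1[of N "N + 1" y "\<lambda>z. - x z - y z * \<phi> (g z)"] dy N by auto
    have yz: "\<bar>y s\<bar> < e" if "s \<ge> N" for s using N2(2)[of s] neg[of s] N2(1) N(3) that by auto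
    have "\<bar>y z * \<phi> (g z)\<bar> \<le> e * B"
      unfolding abs_mult using yz[of z] z(1) \<phi>B[of z] N(1) e(1) by (intro mult_mono) auto
    then have "\<bar>- x z - y z * \<phi> (g z)\<bar> \<ge> \<bar>l\<bar> / 2"
      using N1(2)[of z] z(1) N(2) e(2) by (simp add: abs_if split: if_splits)
    moreover have "\<bar>y (N + 1) - y N\<bar> < e"
    proof -
      have "y N < 0" "y (N + 1) < 0" using neg[of N] neg[of "N + 1"] N1(1) N(2) by auto
      moreover have "- e < y N" "- e < y (N + 1)" using yz[of N] yz[of "N + 1"] by auto
      ultimately show ?thesis by linarith
    qed
    moreover have "e < \<bar>l\<bar> / 2" using e(3) l by simp
    ultimately show False using z(2) by simp
  qed
  obtain N1 where N1: "N1 > t0" "\<And>t. t \<ge> N1 \<Longrightarrow> l \<le> x t \<and> x t < l + m / 2"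
    using xl[of "m / 2"] m by auto
  obtain N2 where N2: "N2 > t0" "\<And>t. t \<ge> N2 \<Longrightarrow> - (m / 2) < y t" using yl[of "m / 2"] m by auto
  define N where "N = max N1 N2"
  have N: "N > t0" "N \<ge> N1" "N \<ge> N2" using N1(1) by (auto simp: N_def)
  have "norm (g N) < m"
    using xy(3)[of N] N1(2)[OF N(2)] N2(2)[OF N(3)] neg[OF N(1)] \<open>l = 0\<close> by linarith
  then show False using mn[of N] N(1) t0 by simp
qed

text \<open>At \<open>(a, 0)\<close> the orbit enters the lower half-plane because
  \<open>y' = - a\<close>, and it cannot remain there. It must leave through the negative axis,
  since at a positive abscissa on the axis \<open>y\<close> is decreasing.\<close>

lemma half_turn:
  assumes g: "solves F g {0..}" and g0: "g 0 = (a, 0)" and a: "a > 0"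
  obtains s b where "s > 0" "b > 0" "g s = (- b, 0)" "\<And>t. 0 < t \<Longrightarrow> t < s \<Longrightarrow> snd (g t) < 0"
proof -
  have nz: "g 0 \<noteq> 0" using g0 a by (simp add: zero_prod_def)
  have cy: "continuous_on {0..} (\<lambda>t. snd (g t))" by (intro continuous_intros solves_continuous_on[OF g])
  have "((\<lambda>t. snd (g t)) has_real_derivative - a) (at 0 within {0..})"
    using solves_snd[OF g, of 0] g0 by simp
  then obtain d where d: "d > 0" "\<And>h. 0 < h \<Longrightarrow> h < d \<Longrightarrow> snd (g h) < 0"
    using has_real_derivative_neg_dec_right[of "\<lambda>t. snd (g t)" "-a" 0 "{0..}"] a g0 by auto
  obtain u where u: "u > d" "snd (g u) \<ge> 0"
    using not_eventually_below[OF g nz, of d] d(1) by auto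
  \<comment> \<open>The search for the first return starts at \<open>d/2\<close>, because
    \<open>snd (g t)\<close> also vanishes at the initial time.\<close>
  define S where "S = {t\<in>{d/2..u}. snd (g t) \<in> {0..}}"
  have "compact S"
    unfolding S_def using d by (intro compact_preimage_Icc continuous_on_subset[OF cy]) auto
  moreover have "u \<in> S" using u d by (auto simp: S_def)
  ultimately obtain s where s: "s \<in> S" "\<And>t. t \<in> S \<Longrightarrow> s \<le> t"
    using compact_attains_inf[of S] by blast
  have s0: "s \<ge> d/2" "s > 0" "s \<le> u" "snd (g s) \<ge> 0" using s(1) d by (auto simp: S_def)
  have neg: "snd (g t) < 0" if "0 < t" "t < s" for t
  proof (cases "t < d")
    case False
    then have "t \<in> {d/2..u}" using that s0 d by auto
    then show ?thesis using s(2)[of t] that by (force simp: S_def)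
  qed (use d that in auto)
  have ys: "snd (g s) = 0"
  proof (rule ccontr)
    assume "snd (g s) \<noteq> 0"
    then have pos: "snd (g s) > 0" using s0 by simp
    have "snd (g (s/2)) \<le> 0" using neg[of "s/2"] s0 by simp
    then obtain t where t: "s/2 \<le> t" "t \<le> s" "snd (g t) = 0"
      using IVT'[of "\<lambda>t. snd (g t)" "s/2" 0 s] s0 continuous_on_subset[OF cy, of "{s/2..s}"] by auto
    then show False using neg[of t] pos s0 by (cases "t = s") auto
  qed
  obtain m where m: "0 < m" "m \<le> norm (g s)" using orbit_bounds[OF g nz] s0 by (metis less_imp_le)
  have "fst (g s) \<noteq> 0" using m ys by (cases "g s") auto
  moreover have "\<not> fst (g s) > 0"
  proof
    assume x: "fst (g s) > 0"
    \<comment> \<open>A negative slope at \<open>s\<close> makes \<open>y\<close> positive just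
      before \<open>s\<close>, whereas it was negative on the whole half turn.\<close>
    have "((\<lambda>t. snd (g t)) has_real_derivative - fst (g s)) (at s)"
      using solves_derivs(2)[OF g s0(2)] ys by simp
    then obtain e where e: "e > 0" "\<And>h. 0 < h \<Longrightarrow> h < e \<Longrightarrow> snd (g (s - h)) > snd (g s)"
      using has_real_derivative_neg_dec_left[of "\<lambda>t. snd (g t)" "- fst (g s)" s UNIV] x by auto
    define h where "h = min e s / 2"
    have "0 < h" "h < e" "h < s" using e s0 by (auto simp: h_def min_def)
    then show False using e(2)[of h] neg[of "s - h"] ys by simp
  qed
  ultimately have x: "- fst (g s) > 0" by linarith
  have "g s = (- (- fst (g s)), 0)" using ys by (cases "g s") auto
  then show thesis by (rule that[OF s0(2) x _ neg])
qed

text \<open>The orbit and its reflection both fail to stay in the open lower half-plane, so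
  \<open>y\<close> takes both signs weakly and has a zero. If this zero lies on the negative axis,
  one more half turn of the reflected system reaches the positive axis.\<close>

lemma crosses_positive_axis:
  assumes g: "solves F g {0..}" and nz: "g 0 \<noteq> 0"
  obtains t a where "t \<ge> 0" "a > 0" "g t = (a, 0)"
proof -
  interpret r: star_damping "\<lambda>p. \<phi> (- p)" R \<rho> by (rule reflect)
  have cy: "continuous_on {0..} (\<lambda>t. snd (g t))" by (intro continuous_intros solves_continuous_on[OF g])
  have cyI: "continuous_on {r..t} (\<lambda>t. snd (g t))" if "r \<ge> 0" for r t
    using cy by (rule continuous_on_subset) (use that in auto)
  obtain t1 where t1: "t1 > 0" "snd (g t1) \<ge> 0"
    using not_eventually_below[OF g nz, of 0] by auto
  obtain t2 where t2: "t2 > 0" "snd (g t2) \<le> 0"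
    using r.not_eventually_below[OF solves_reflect[OF g], of 0] nz by auto
  obtain t where t: "t \<ge> 0" "snd (g t) = 0"
  proof (cases "t1 \<le> t2")
    case True
    then obtain z where "t1 \<le> z" "snd (g z) = 0"
      using IVT2'[of "\<lambda>t. snd (g t)" t2 0 t1] t1 t2 cyI[of t1 t2] by auto
    then show thesis using that[of z] t1 by simp
  next
    case False
    then obtain z where "t2 \<le> z" "snd (g z) = 0"
      using IVT'[of "\<lambda>t. snd (g t)" t2 0 t1] t1 t2 cyI[of t2 t1] by auto
    then show thesis using that[of z] t2 by simp
  qed
  obtain m where m: "0 < m" "m \<le> norm (g t)" using orbit_bounds[OF g nz] t(1) by metis
  have gt: "g t = (fst (g t), 0)" using t(2) by (cases "g t") auto
  have x: "fst (g t) \<noteq> 0" using m gt by (cases "g t") auto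
  show thesis
  proof (cases "fst (g t) > 0")
    case True
    then show thesis using that[OF t(1) _ gt] by simp
  next
    case False
    have "solves F (\<lambda>s. g (s + t)) {0..}" by (rule solves_shift[OF g]) (use t in auto)
    from r.half_turn[OF solves_reflect[OF this], of "- fst (g t)"]
    obtain s b where "s > 0" "b > 0" "- g (s + t) = (- b, 0)"
      using gt False x by (metis add_0 linorder_neqE_linordered_idom minus_zero neg_0_less_iff_less uminus_Pair)
    then show thesis using that[of "s + t" b] t(1) by (cases "g (s + t)") auto
  qed
qed

text \<open>In the lower half-plane \<open>x' = y < 0\<close>, so time is a function of
  \<open>x\<close> with derivative \<open>1 / y\<close>. The last two conclusions allow the orbit
  segment to be recovered as the full graph of \<open>w\<close>.\<close>

lemma solution_arc:
  assumes g: "solves F g {0..s}" and s: "s > 0" and a: "a > 0" and b: "b > 0"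
    and g0: "g 0 = (a, 0)" and gs: "g s = (- b, 0)"
    and neg: "\<And>t. 0 < t \<Longrightarrow> t < s \<Longrightarrow> snd (g t) < 0"
  obtains w where "arc \<phi> a b w" "(\<lambda>t. fst (g t)) ` {0..s} = {-b..a}"
    "\<And>t. t \<in> {0..s} \<Longrightarrow> w (fst (g t)) = snd (g t)"
proof -
  define x where "x = (\<lambda>t. fst (g t))"
  define y where "y = (\<lambda>t. snd (g t))"
  have dx: "(x has_real_derivative y t) (at t)" if "0 < t" "t < s" for t
    using solves_fst[OF g, of t] that by (simp add: x_def y_def at_within_Icc_at)
  have dy: "(y has_real_derivative - x t - y t * \<phi> (g t)) (at t)" if "0 < t" "t < s" for t
    using solves_snd[OF g, of t] that by (simp add: x_def y_def at_within_Icc_at)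
  have cx: "continuous_on {0..s} x" and cy: "continuous_on {0..s} y"
    unfolding x_def y_def by (intro continuous_intros solves_continuous_on[OF g])+
  have dec: "x t < x r" if "0 \<le> r" "r < t" "t \<le> s" for r t
  proof (rule DERIV_neg_imp_decreasing_open[of r t x])
    show "continuous_on {r..t} x" by (rule continuous_on_subset[OF cx]) (use that in auto)
    show "\<And>z. r < z \<Longrightarrow> z < t \<Longrightarrow> \<exists>k. (x has_real_derivative k) (at z) \<and> k < 0"
      using dx neg that by (metis le_less_trans less_le_trans y_def)
  qed fact
  have inj: "inj_on x {0..s}"
  proof (rule inj_onI)
    fix r t assume rt: "r \<in> {0..s}" "t \<in> {0..s}" "x r = x t"
    show "r = t" using dec[of r t] dec[of t r] rt by (cases r t rule: linorder_cases) auto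
  qed
  have x0: "x 0 = a" and xs: "x s = - b" using g0 gs by (auto simp: x_def)
  have img: "x ` {0..s} = {-b..a}"
  proof (intro equalityI subsetI)
    fix z assume "z \<in> x ` {0..s}"
    then obtain t where t: "t \<in> {0..s}" "z = x t" by auto
    have "x t \<le> x 0" using dec[of 0 t] t by (cases "t = 0") auto
    moreover have "x s \<le> x t" using dec[of t s] t by (cases "t = s") auto
    ultimately show "z \<in> {-b..a}" using t x0 xs by auto
  next
    fix z assume z: "z \<in> {-b..a}"
    then obtain t where "0 \<le> t" "t \<le> s" "x t = z"
      using IVT2'[of x s z 0] x0 xs s cx by auto
    then show "z \<in> x ` {0..s}" by auto
  qed
  define u where "u = inv_into {0..s} x"
  have ux: "u (x t) = t" if "t \<in> {0..s}" for t using inv_into_f_f[OF inj that] by (simp add: u_def)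
  have xu: "x (u z) = z" and us: "u z \<in> {0..s}" if "z \<in> {-b..a}" for z
    using that img f_inv_into_f[of z x "{0..s}"] inv_into_into[of z x "{0..s}"] by (auto simp: u_def)
  have cu: "continuous_on {-b..a} u"
    using continuous_on_inv[OF cx, of u] ux img by simp
  have ui: "0 < u z" "u z < s" if "z \<in> {-b<..<a}" for z
  proof -
    have "u z \<noteq> 0" "u z \<noteq> s" using xu[of z] that x0 xs by auto
    then show "0 < u z" "u z < s" using us[of z] that by auto
  qed
  define w where "w = (\<lambda>z. y (u z))"
  have "arc \<phi> a b w"
    unfolding arc_def
  proof (intro conjI ballI)
    show "continuous_on {-b..a} w" unfolding w_def by (rule continuous_on_compose2[OF cy cu]) (use us in auto)
    show "w a = 0" using ux[of 0] x0 s g0 by (simp add: w_def y_def)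
    show "w (-b) = 0" using ux[of s] xs s gs by (simp add: w_def y_def)
    fix z assume z: "z \<in> {-b<..<a}"
    have wz: "w z < 0" using neg ui[OF z] by (simp add: w_def y_def)
    then show "w z < 0" .
    have cuz: "isCont u z" using cu z by (simp add: continuous_on_interior)
    have "(u has_real_derivative inverse (y (u z))) (at z)"
      by (rule DERIV_inverse_function[where f=x and a="-b" and b=a])
         (use dx[OF ui[OF z]] wz z xu cuz in \<open>auto simp: w_def\<close>)
    then have "(w has_real_derivative (- x (u z) - y (u z) * \<phi> (g (u z))) * inverse (y (u z))) (at z)"
      unfolding w_def by (rule DERIV_chain2[where g=u, OF dy[OF ui[OF z]]])
    moreover have "g (u z) = (z, w z)" using xu[of z] z by (simp add: w_def x_def y_def prod_eq_iff)
    moreover have "x (u z) = z" using xu[of z] z by simp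
    ultimately have "(w has_real_derivative (- z - w z * \<phi> (z, w z)) * inverse (w z)) (at z)"
      by (simp add: w_def)
    then show "(w has_real_derivative - z / w z - \<phi> (z, w z)) (at z)"
      by (rule DERIV_cong) (use wz in \<open>simp add: field_simps\<close>)
  qed (use a b in auto)
  moreover have "w (x t) = y t" if "t \<in> {0..s}" for t using ux[OF that] by (simp add: w_def)
  ultimately show thesis using that[of w] img unfolding x_def y_def by simp
qed

end

section \<open>Comparison of half turns\<close>

text \<open>The limit \<open>l \<rightarrow> 1\<close> in multiplicative estimates. The factor
  \<open>(v + u) / (2 * v)\<close> in the proof moves \<open>v\<close> to the midpoint of
  \<open>v\<close> and \<open>u\<close>.\<close>

lemma le_if_less_scaled:
  fixes u v :: real
  assumes "v > 0" "\<And>l. l > 1 \<Longrightarrow> u \<le> l * v"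
  shows "u \<le> v"
proof (rule ccontr)
  assume "\<not> u \<le> v"
  then have "(v + u) / (2 * v) > 1" "(v + u) / (2 * v) * v < u" using assms(1) by (auto simp: field_simps)
  then show False using assms(2)[of "(v + u) / (2 * v)"] by linarith
qed

text \<open>Taking \<open>l\<close> close to 1 in the scaling inequality gives monotonicity and lets
  \<open>P\<close> pass to the limit. The iterates are therefore monotone, and the two bounds keep
  their limit finite and positive.\<close>

lemma sublinear_map_attracting_fixpoint:
  fixes P :: "real \<Rightarrow> real"
  assumes pos: "\<And>a. a > 0 \<Longrightarrow> P a > 0"
    and scale: "\<And>l a b. l > 1 \<Longrightarrow> a > 0 \<Longrightarrow> b > 0 \<Longrightarrow> b \<le> l * a \<Longrightarrow> P b < l * P a"
    and up: "\<And>a. a > 0 \<Longrightarrow> P a \<le> max a R"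
    and lo: "\<And>a. a > 0 \<Longrightarrow> min a \<rho> \<le> P a" and "\<rho> > 0"
  obtains c where "c > 0" "P c = c" "\<And>a. a > 0 \<Longrightarrow> (\<lambda>n. (P ^^ n) a) \<longlonglongrightarrow> c"
proof -
  have mono: "P a \<le> P b" if ab: "0 < a" "a \<le> b" for a b
  proof (rule le_if_less_scaled)
    show "P b > 0" using pos ab by simp
    fix l :: real assume "l > 1"
    then have "a \<le> l * b" using ab mult_right_mono[of 1 l b] by linarith
    then show "P a \<le> l * P b" using scale[of l b a] \<open>l > 1\<close> ab by simp
  qed
  have uniq: "a = b" if "a > 0" "b > 0" "P a = a" "P b = b" for a b
  proof -
    \<comment> \<open>The factor \<open>l = b / a\<close> turns the scaling inequality into
      \<open>b < b\<close>.\<close>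
    have *: False if "0 < a" "a < b" "P a = a" "P b = b" for a b
      using scale[of "b / a" a b] that by simp
    show ?thesis using *[of a b] *[of b a] that by (cases a b rule: linorder_cases) auto
  qed
  have conv: "\<exists>c>0. P c = c \<and> (\<lambda>n. (P ^^ n) a) \<longlonglongrightarrow> c" if a: "a > 0" for a
  proof -
    define s where "s = (\<lambda>n. (P ^^ n) a)"
    have sS: "s (Suc n) = P (s n)" for n by (simp add: s_def)
    have sb: "min a \<rho> \<le> s n \<and> s n \<le> max a R" for n
    proof (induction n)
      case (Suc n)
      then have "s n > 0" using a \<open>\<rho> > 0\<close> by linarith
      then show ?case using Suc up[of "s n"] lo[of "s n"] unfolding sS by linarith
    qed (simp add: s_def)
    then have spos: "s n > 0" for n using a \<open>\<rho> > 0\<close> by (metis less_le_trans min_less_iff_conj)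
    have "monoseq s"
    proof (cases "a \<le> P a")
      case True
      have "s n \<le> s (Suc n)" for n
      proof (induction n)
        case (Suc n)
        then show ?case using mono spos[of n] spos[of "Suc n"] by (simp add: sS)
      qed (use True in \<open>simp add: s_def\<close>)
      then show ?thesis by (simp add: incseq_SucI incseq_imp_monoseq)
    next
      case False
      have "s (Suc n) \<le> s n" for n
      proof (induction n)
        case (Suc n)
        then show ?case using mono spos[of n] spos[of "Suc n"] by (simp add: sS)
      qed (use False in \<open>simp add: s_def\<close>)
      then show ?thesis by (simp add: decseq_SucI decseq_imp_monoseq)
    qed
    moreover have "Bseq s"
      by (rule BseqI'[of _ "max a R"]) (use sb spos in \<open>auto simp: less_imp_le abs_of_pos\<close>)
    ultimately obtain c where c: "s \<longlonglongrightarrow> c" using Bseq_monoseq_convergent by (auto simp: convergent_def)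
    have "min a \<rho> \<le> c" by (rule LIMSEQ_le_const[OF c]) (use sb in auto)
    then have c0: "c > 0" using a \<open>\<rho> > 0\<close> by linarith
    have cS: "(\<lambda>n. P (s n)) \<longlonglongrightarrow> c" using LIMSEQ_Suc[OF c] by (simp add: sS)
    \<comment> \<open>The iterates are eventually within a factor \<open>l\<close> of
      \<open>c\<close>, so the scaling inequality compares \<open>P (s n)\<close> with
      \<open>P c\<close> in both directions; this shows that \<open>c\<close> is a fixed
      point.\<close>
    have near: "\<forall>\<^sub>F n in sequentially. s n \<le> l * c \<and> c \<le> l * s n" if "l > 1" for l
    proof -
      have "c < l * c" "c / l < c" using that c0 by (auto simp: field_simps)
      then have "\<forall>\<^sub>F n in sequentially. s n < l * c \<and> c / l < s n"
        using order_tendstoD[OF c] by (auto intro: eventually_conj)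
      then show ?thesis using that by (auto elim!: eventually_mono simp: field_simps)
    qed
    have "c \<le> P c"
    proof (rule le_if_less_scaled[OF pos[OF c0]])
      fix l :: real assume l: "l > 1"
      have "\<forall>\<^sub>F n in sequentially. P (s n) \<le> l * P c"
        using near[OF l] by eventually_elim (use scale[OF l c0 spos] in \<open>auto intro: less_imp_le\<close>)
      then show "c \<le> l * P c" using cS by (intro tendsto_upperbound[of "\<lambda>n. P (s n)" c sequentially]) auto
    qed
    moreover have "P c \<le> c"
    proof (rule le_if_less_scaled[OF c0])
      fix l :: real assume l: "l > 1"
      have "\<forall>\<^sub>F n in sequentially. P c \<le> l * P (s n)"
        using near[OF l] by eventually_elim (use scale[OF l spos c0] in \<open>auto intro: less_imp_le\<close>)
      then show "P c \<le> l * c"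
        by (intro tendsto_lowerbound[of "\<lambda>n. l * P (s n)" "l * c" sequentially] tendsto_intros cS) auto
    qed
    ultimately show ?thesis using c c0 by (auto simp: s_def)
  qed
  obtain c where "c > 0" "P c = c" using conv[of 1] by auto
  then show thesis using conv uniq by (intro that[of c]) metis+
qed

lemma divide_between:
  fixes l :: real
  assumes "l > 0" "- (l * b) < x" "x < l * a"
  shows "- b < x / l" "x / l < a"
  using assms by (simp_all add: field_simps)

lemma arcD:
  assumes "arc \<phi> a b w"
  shows "a > 0" "b > 0" "continuous_on {-b..a} w" "w a = 0" "w (-b) = 0"
    "\<And>x. - b < x \<Longrightarrow> x < a \<Longrightarrow> w x < 0"
    "\<And>x. - b < x \<Longrightarrow> x < a \<Longrightarrow> (w has_real_derivative - x / w x - \<phi> (x, w x)) (at x)"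
  using assms unfolding arc_def by auto

lemma scaled_arc_continuous_on:
  assumes "arc \<phi> a b w" "l > 0"
  shows "continuous_on {-l*b..l*a} (\<lambda>x. l * w (x / l))"
  using assms(2)
  by (intro continuous_intros continuous_on_compose2[OF arcD(3)[OF assms(1)]]) (auto simp: field_simps)

context star_damping
begin

text \<open>Dilation preserves \<open>- x / y\<close>, so these terms cancel at a touching point and
  the derivative is the difference of the two damping values, which \<open>ray\<close> makes
  negative. Hence zeros of the difference are crossed only downwards as \<open>x\<close>
  increases.\<close>

lemma touching_deriv_neg:
  assumes arc1: "arc \<phi> a1 b1 w1" and arc2: "arc \<phi> a2 b2 w2" and l: "l > 1"
    and z2: "- b2 < z" "z < a2" and z1: "- b1 < z / l" "z / l < a1" and touch: "w2 z = l * w1 (z / l)"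
  shows "\<exists>k<0. ((\<lambda>x. w2 x - l * w1 (x / l)) has_real_derivative k) (at z)"
proof -
  let ?w = "w1 (z / l)"
  have w: "?w < 0" using arcD(6)[OF arc1 z1] .
  have "((\<lambda>x. x / l) has_real_derivative 1 / l) (at z)" using l by (auto intro!: derivative_eq_intros)
  then have "((\<lambda>x. w1 (x / l)) has_real_derivative (- (z / l) / ?w - \<phi> (z / l, ?w)) * (1 / l)) (at z)"
    by (rule DERIV_chain2[where g="\<lambda>x. x / l", OF arcD(7)[OF arc1 z1]])
  then have "((\<lambda>x. w2 x - l * w1 (x / l)) has_real_derivative
      (- z / w2 z - \<phi> (z, w2 z)) - l * ((- (z / l) / ?w - \<phi> (z / l, ?w)) * (1 / l))) (at z)"
    by (intro DERIV_diff arcD(7)[OF arc2 z2] DERIV_cmult)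
  moreover have "(- z / w2 z - \<phi> (z, w2 z)) - l * ((- (z / l) / ?w - \<phi> (z / l, ?w)) * (1 / l))
      = \<phi> (z / l, ?w) - \<phi> (z, w2 z)"
    using l w by (simp add: touch field_simps)
  moreover have "\<phi> (z / l, ?w) < \<phi> (z, w2 z)"
    using ray[of "(z / l, ?w)" l] l w by (simp add: touch zero_prod_def)
  ultimately show ?thesis by (metis diff_less_0_iff_less)
qed

text \<open>Since zeros are crossed only downwards, positivity of the difference at
  \<open>x0\<close> propagates to the left: just to the right of the last zero before
  \<open>x0\<close> the difference would be negative.\<close>

lemma arc_compare_from:
  assumes arc1: "arc \<phi> a1 b1 w1" and arc2: "arc \<phi> a2 b2 w2" and l: "l > 1"
    and x0: "x0 \<le> a2" "x0 \<le> l * a1" "- b2 < x0" "- l * b1 < x0" and start: "l * w1 (x0 / l) < w2 x0"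
  shows "b2 \<le> l * b1" "\<And>x. - b2 < x \<Longrightarrow> x \<le> x0 \<Longrightarrow> l * w1 (x / l) < w2 x"
proof -
  define D where "D = (\<lambda>x. w2 x - l * w1 (x / l))"
  \<comment> \<open>The left end of the common domain of \<open>w2\<close> and the dilated
    \<open>w1\<close>.\<close>
  define c where "c = max (- b2) (- l * b1)"
  have c: "c < x0" "- b2 \<le> c" "- l * b1 \<le> c" using x0 by (auto simp: c_def)
  have cD: "continuous_on {c..x0} D"
    unfolding D_def
    by (intro continuous_on_diff continuous_on_subset[OF arcD(3)[OF arc2]]
        continuous_on_subset[OF scaled_arc_continuous_on[OF arc1]]) (use l c x0 in auto)
  have D0: "D x0 > 0" using start by (simp add: D_def)
  have pos: "D x > 0" if x: "c < x" "x \<le> x0" for x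
  proof (rule ccontr)
    assume neg: "\<not> D x > 0"
    define S where "S = {z\<in>{x..x0}. D z \<in> {..0}}"
    have cD': "continuous_on {z..x0} D" if "z \<ge> x" for z
      by (rule continuous_on_subset[OF cD]) (use x that in auto)
    have "compact S" unfolding S_def by (intro compact_preimage_Icc cD') auto
    moreover have "x \<in> S" using neg x by (auto simp: S_def)
    ultimately obtain z where z: "z \<in> S" "\<And>y. y \<in> S \<Longrightarrow> y \<le> z"
      using compact_attains_sup[of S] by blast
    have z0: "x \<le> z" "z \<le> x0" "D z \<le> 0" using z(1) by (auto simp: S_def)
    then have zx: "z < x0" using D0 by (cases "z = x0") auto
    have right: "D y > 0" if "z < y" "y \<le> x0" for y
      using z(2)[of y] that z0 by (force simp: S_def)
    have Dz: "D z = 0"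
    proof -
      obtain y where "z \<le> y" "y \<le> x0" "D y = 0"
        using IVT'[of D z 0 x0] z0 D0 cD'[of z] by auto
      then show ?thesis using right[of y] by (cases "y = z") auto
    qed
    have "- l * b1 < z" "z < l * a1" using z0 x c zx x0 by auto
    then have "- b1 < z / l" "z / l < a1" using l divide_between[of l b1 z a1] by auto
    then obtain k where k: "k < 0" "(D has_real_derivative k) (at z)"
      using touching_deriv_neg[OF arc1 arc2 l, of z] Dz z0 x c zx x0 unfolding D_def by auto
    obtain d where d: "d > 0" "\<And>h. 0 < h \<Longrightarrow> h < d \<Longrightarrow> D (z + h) < D z"
      using has_real_derivative_neg_dec_right[OF k(2) k(1)] by auto
    define h where "h = min d (x0 - z) / 2"
    have "0 < h" "h < d" "z + h \<le> x0" using d zx by (auto simp: h_def min_def field_simps)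
    then show False using d(2)[of h] right[of "z + h"] Dz by simp
  qed
  show b: "b2 \<le> l * b1"
  proof (rule ccontr)
    assume "\<not> b2 \<le> l * b1"
    \<comment> \<open>Otherwise the dilated first arc reaches the axis while \<open>w2\<close> is
      still negative, so the difference would be negative at \<open>c\<close> and vanish between
      \<open>c\<close> and \<open>x0\<close>.\<close>
    then have c': "c = - l * b1" "- b2 < c" by (auto simp: c_def)
    then have "D c < 0"
      using arcD(6)[OF arc2, of c] c x0 l arcD(5)[OF arc1] by (simp add: D_def)
    then obtain y where "c \<le> y" "y \<le> x0" "D y = 0"
      using IVT'[of D c 0 x0] D0 cD c by auto
    then show False using pos[of y] \<open>D c < 0\<close> by (cases "y = c") auto
  qed
  show "l * w1 (x / l) < w2 x" if "- b2 < x" "x \<le> x0" for x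
    using pos[of x] that b by (auto simp: c_def D_def)
qed

text \<open>At \<open>a2 = l * a1\<close> both curves start at the same point, where the slope is infinite; so the
  comparison is first made with dilation factors \<open>m > l\<close>. Strictness at the far end comes from
  restarting at an interior point with a factor slightly below \<open>l\<close>.\<close>

lemma arc_compare:
  assumes arc1: "arc \<phi> a1 b1 w1" and arc2: "arc \<phi> a2 b2 w2" and l: "l > 1" and a: "a2 \<le> l * a1"
  shows "b2 < l * b1" "\<And>x. - b2 < x \<Longrightarrow> x < a2 \<Longrightarrow> l * w1 (x / l) < w2 x"
proof -
  note pos = arcD(1,2)[OF arc1] arcD(1,2)[OF arc2]
  have bigger: "b2 \<le> m * b1" "\<And>x. - b2 < x \<Longrightarrow> x \<le> a2 \<Longrightarrow> m * w1 (x / m) < w2 x" if m: "m > l" for m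
  proof -
    have am: "a2 < m * a1" using a m pos by (smt (verit) mult_strict_right_mono)
    have "- m * b1 < 0" using m l pos by simp
    then have "- m * b1 < a2" using pos by linarith
    moreover have "m * w1 (a2 / m) < w2 a2"
    proof -
      have "- b1 < a2 / m" "a2 / m < a1"
        using divide_between[of m b1 a2 a1] am \<open>- m * b1 < a2\<close> m l by auto
      then have "w1 (a2 / m) < 0" by (rule arcD(6)[OF arc1])
      then show ?thesis using arcD(4)[OF arc2] m l by (simp add: mult_pos_neg)
    qed
    ultimately show "b2 \<le> m * b1" "\<And>x. - b2 < x \<Longrightarrow> x \<le> a2 \<Longrightarrow> m * w1 (x / m) < w2 x"
      using arc_compare_from[OF arc1 arc2, of m a2] am m l pos by auto
  qed
  have b: "b2 \<le> l * b1"
  proof (rule le_if_less_scaled)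
    fix m :: real assume "m > 1"
    then show "b2 \<le> m * (l * b1)" using bigger(1)[of "m * l"] l by (simp add: mult.assoc)
  qed (use l pos in simp)
  have inside: "- b1 < x / l" "x / l < a1" if "- b2 < x" "x < a2" for x
    using divide_between[of l b1 x a1] that a b l by auto
  have lim: "((\<lambda>m. m * w1 (x / m)) \<longlongrightarrow> l * w1 (x / l)) (at l within T)" if "- b2 < x" "x < a2" for x T
  proof -
    have "isCont w1 (x / l)" by (rule DERIV_isCont[OF arcD(7)[OF arc1 inside[OF that]]])
    moreover have "((\<lambda>m. x / m) \<longlongrightarrow> x / l) (at l within T)" using l by (intro tendsto_intros) auto
    ultimately show ?thesis
      by (intro tendsto_mult tendsto_ident_at) (rule isCont_tendsto_compose)
  qed
  define D where "D = (\<lambda>x. w2 x - l * w1 (x / l))"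
  have D0: "D x \<ge> 0" if x: "- b2 < x" "x < a2" for x
  proof -
    have "\<forall>\<^sub>F m in at_right l. m * w1 (x / m) \<le> w2 x"
      using bigger(2)[of _ x] x by (auto simp: eventually_at_right_field intro!: exI[of _ "l + 1"] less_imp_le)
    then have "l * w1 (x / l) \<le> w2 x" by (intro tendsto_upperbound[OF lim[OF x]]) auto
    then show ?thesis by (simp add: D_def)
  qed
  \<comment> \<open>As \<open>D\<close> is nonnegative, an interior zero would be a minimum, against
    its negative derivative there.\<close>
  show strict: "l * w1 (x / l) < w2 x" if x: "- b2 < x" "x < a2" for x
  proof (rule ccontr)
    assume "\<not> ?thesis"
    then have Dx: "D x = 0" using D0[OF x] by (simp add: D_def)
    then obtain k where k: "k < 0" "(D has_real_derivative k) (at x)"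
      using touching_deriv_neg[OF arc1 arc2 l x inside[OF x]] unfolding D_def by auto
    obtain d where d: "d > 0" "\<And>h. 0 < h \<Longrightarrow> h < d \<Longrightarrow> D (x + h) < D x"
      using has_real_derivative_neg_dec_right[OF k(2) k(1)] by auto
    define h where "h = min d (a2 - x) / 2"
    have "0 < h" "h < d" "x + h < a2" using d x by (auto simp: h_def min_def field_simps)
    then show False using d(2)[of h] D0[of "x + h"] Dx x by simp
  qed
  show "b2 < l * b1"
  proof -
    let ?x = "(a2 - b2) / 2"
    have x: "- b2 < ?x" "?x < a2" using pos by auto
    have "\<forall>\<^sub>F m in at_left l. m * w1 (?x / m) < w2 ?x"
      using order_tendstoD(2)[OF lim[OF x] strict[OF x]] .
    moreover have "\<forall>\<^sub>F m in at_left l. 1 < m \<and> m < l"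
      using l by (auto simp: eventually_at_left_field)
    moreover have "\<forall>\<^sub>F m in at_left l. ?x < m * a1"
      using x a by (intro order_tendstoD(1)[of _ "l * a1"] tendsto_intros) auto
    moreover have "\<forall>\<^sub>F m in at_left l. - ?x < m * b1"
    proof (rule order_tendstoD(1))
      show "((\<lambda>m. m * b1) \<longlongrightarrow> l * b1) (at_left l)" by (intro tendsto_intros)
      show "- ?x < l * b1" using x b by linarith
    qed
    ultimately have "\<forall>\<^sub>F m in at_left l. b2 \<le> m * b1 \<and> m < l"
    proof eventually_elim
      case (elim m)
      then have "- m * b1 < ?x" unfolding mult_minus_left by linarith
      then show ?case using arc_compare_from(1)[OF arc1 arc2, of m ?x] x elim by auto
    qed
    then obtain m where "b2 \<le> m * b1" "m < l"
      using eventually_happens[of _ "at_left l"] by auto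
    then show ?thesis using pos by (smt (verit) mult_strict_right_mono)
  qed
qed

text \<open>The arc \<open>w\<close> lies between the dilations of \<open>w'\<close> by
  \<open>1 / l\<close> and by \<open>l\<close>. So by the intermediate value theorem the ray through
  a point of \<open>w\<close> meets \<open>w'\<close> at a multiple \<open>s\<close> of that point
  with \<open>1 / l \<le> s \<le> l\<close>, at distance
  \<open>\<bar>1 - s\<bar> * norm (x, w x)\<close>.\<close>

lemma arc_close:
  assumes arc1: "arc \<phi> a b w" and arc2: "arc \<phi> a' b' w'" and l: "l > 1"
    and a: "a \<le> l * a'" "a' \<le> l * a" and x: "x \<in> {-b..a}"
  shows "\<exists>x'\<in>{-b'..a'}. dist (x, w x) (x', w' x') \<le> (l - 1) * norm (x, w x)"
proof -
  note pos = arcD(1,2)[OF arc1] arcD(1,2)[OF arc2]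
  have b: "b < l * b'" "b' < l * b" using arc_compare(1)[OF arc2 arc1 l] arc_compare(1)[OF arc1 arc2 l] a by auto
  \<comment> \<open>This says \<open>1 - 1 / l \<le> l - 1\<close>, so every factor between
    \<open>1 / l\<close> and \<open>l\<close> differs from 1 by at most
    \<open>l - 1\<close>.\<close>
  have l2: "2 - l \<le> 1 / l"
  proof -
    have "0 \<le> (l - 1)\<^sup>2" by simp
    then show ?thesis using l by (simp add: field_simps power2_eq_square)
  qed
  have ends: "\<bar>u - v\<bar> \<le> (l - 1) * u" if uv: "u \<le> l * v" "v \<le> l * u" "u > 0" for u v
  proof -
    have "(2 - l) * u \<le> (1 / l) * u" using l2 uv by (intro mult_right_mono) auto
    also have "\<dots> \<le> v" using uv l by (simp add: field_simps)
    finally show ?thesis using uv by (simp add: abs_if algebra_simps)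
  qed
  consider "x = a" | "x = - b" | "- b < x" "x < a" using x by force
  then show ?thesis
  proof cases
    case 1
    then show ?thesis
      using ends[of a a'] a pos arcD(4)[OF arc1] arcD(4)[OF arc2]
      by (intro bexI[of _ a']) (auto simp: dist_Pair_Pair norm_Pair dist_real_def)
  next
    case 2
    then show ?thesis
      using ends[of b b'] b pos arcD(5)[OF arc1] arcD(5)[OF arc2]
      by (intro bexI[of _ "- b'"]) (auto simp: dist_Pair_Pair norm_Pair dist_real_def abs_minus_commute)
  next
    case 3
    have wx: "w x < 0" using arcD(6)[OF arc1 3] .
    \<comment> \<open>For large \<open>s\<close> the point \<open>s * x\<close> may leave the domain
      of \<open>w'\<close>, so \<open>w'\<close> is continued by 0. A zero of \<open>f\<close>
      cannot lie out there, because \<open>s * w x < 0\<close>.\<close>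
    define W where "W = (\<lambda>z. w' (max (- b') (min a' z)))"
    have Win: "W z = w' z" if "- b' < z" "z < a'" for z using that by (simp add: W_def)
    have Wout: "W z = 0" if "\<not> (- b' < z \<and> z < a')" for z
      using that pos arcD(4,5)[OF arc2] by (auto simp: W_def max_def min_def)
    have cW: "continuous_on UNIV W"
      unfolding W_def
      by (rule continuous_on_compose2[OF arcD(3)[OF arc2]]) (use pos in \<open>auto intro!: continuous_intros\<close>)
    define f where "f = (\<lambda>s. s * w x - W (s * x))"
    have f1: "f (1 / l) \<ge> 0"
    proof -
      have "- b' < x / l" "x / l < a'"
        using divide_between[of l b' x a'] 3 a b l by auto
      then show ?thesis
        using arc_compare(2)[OF arc2 arc1 l a(1) 3] Win[of "x / l"] l by (simp add: f_def field_simps)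
    qed
    have f2: "f l \<le> 0"
    proof (cases "- b' < l * x \<and> l * x < a'")
      case True
      then show ?thesis
        using arc_compare(2)[OF arc1 arc2 l a(2), of "l * x"] Win[of "l * x"] l by (simp add: f_def)
    qed (use wx l Wout in \<open>simp add: f_def mult_pos_neg less_imp_le\<close>)
    have "continuous_on {1/l..l} f"
      unfolding f_def by (intro continuous_intros continuous_on_compose2[OF cW]) auto
    moreover have "1 / l \<le> l" using l by (simp add: field_simps) (smt (verit) mult_less_cancel_right2)
    ultimately obtain s where s: "1 / l \<le> s" "s \<le> l" "f s = 0"
      using IVT2'[of f l 0 "1/l"] f1 f2 by auto
    have "s > 0" using s(1) l by (smt (verit) divide_pos_pos)
    then have "W (s * x) < 0" using s(3) mult_pos_neg[OF \<open>s > 0\<close> wx] by (simp add: f_def)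
    then have sx: "- b' < s * x" "s * x < a'" using Wout[of "s * x"] by auto
    then have ws: "w' (s * x) = s * w x" using s(3) Win by (simp add: f_def)
    have "dist (x, w x) (s * x, w' (s * x)) = norm ((1 - s) *\<^sub>R (x, w x))"
      by (simp add: dist_norm ws algebra_simps)
    also have "\<dots> = \<bar>1 - s\<bar> * norm (x, w x)" by (simp only: norm_scaleR)
    also have "\<dots> \<le> (l - 1) * norm (x, w x)"
      using s l2 by (intro mult_right_mono) auto
    finally show ?thesis using sx by (intro bexI[of _ "s * x"]) auto
  qed
qed

end

section \<open>The return map\<close>

lemma tendsto_at_top_shift:
  fixes f :: "real \<Rightarrow> 'a::topological_space"
  assumes "((\<lambda>r. f (r + t)) \<longlongrightarrow> l) at_top"
  shows "(f \<longlongrightarrow> l) at_top"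
proof -
  have "LIM r at_top. - t + r :> at_top"
    by (rule filterlim_tendsto_add_at_top[OF tendsto_const filterlim_ident])
  from filterlim_compose[OF assms this] show ?thesis by simp
qed

context star_damping
begin

lemma arc_exists: "a > 0 \<Longrightarrow> \<exists>b w. arc \<phi> a b w"
proof -
  assume a: "a > 0"
  obtain g where g: "g 0 = (a, 0)" "solves F g {0..}" using forward_solution by blast
  obtain s b where s: "s > 0" "b > 0" "g s = (- b, 0)" "\<And>t. 0 < t \<Longrightarrow> t < s \<Longrightarrow> snd (g t) < 0"
    using half_turn[OF g(2,1) a] by blast
  have "solves F g {0..s}" by (rule solves_subset[OF g(2)]) auto
  then show ?thesis by (rule solution_arc[OF _ s(1) a s(2) g(1) s(3,4)]) blast+
qed

definition endpoint :: "real \<Rightarrow> real" where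
  "endpoint a = (SOME b. \<exists>w. arc \<phi> a b w)"

text \<open>Two arcs from the same point can be compared in both orders with every factor
  \<open>l > 1\<close>; letting \<open>l \<rightarrow> 1\<close> gives equal ends. So the choice in
  \<open>endpoint\<close> is well defined, and the half-turn map depends on no particular
  solution.\<close>

lemma endpoint_eq:
  assumes "arc \<phi> a b w"
  shows "endpoint a = b"
proof -
  have le: "b2 \<le> b1" if "arc \<phi> a b1 w1" "arc \<phi> a b2 w2" for b1 b2 w1 w2
  proof (rule le_if_less_scaled)
    show "b1 > 0" using arcD(2)[OF that(1)] .
    fix l :: real assume l: "l > 1"
    then have "a \<le> l * a" using arcD(1)[OF that(1)] by simp
    then show "b2 \<le> l * b1" using arc_compare(1)[OF that l] by simp
  qed
  have "\<exists>w. arc \<phi> a (endpoint a) w" unfolding endpoint_def by (rule someI) (use assms in blast)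
  then obtain w' where "arc \<phi> a (endpoint a) w'" by blast
  then show ?thesis using le assms by (meson order_antisym)
qed

lemma endpoint_arc:
  assumes "a > 0"
  obtains w where "arc \<phi> a (endpoint a) w"
  using arc_exists[OF assms] endpoint_eq by metis

lemma endpoint_scale:
  assumes "l > 1" "a > 0" "b > 0" "b \<le> l * a"
  shows "endpoint b < l * endpoint a"
  using assms by (metis endpoint_arc arc_compare(1))

lemma endpoint_pos: "a > 0 \<Longrightarrow> endpoint a > 0"
  by (metis endpoint_arc arcD(2))

interpretation refl: star_damping "\<lambda>p. \<phi> (- p)" R \<rho> by (rule reflect)

definition return_map :: "real \<Rightarrow> real" where
  "return_map a = refl.endpoint (endpoint a)"

text \<open>The image equations describe the orbit at every time of the turn, not only at the axis,
  so that closeness of arcs becomes closeness of orbits. The second half is a half turn of the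
  reflected system.\<close>

lemma full_turn:
  assumes g: "solves F g {0..}" and g0: "g 0 = (a, 0)" and a: "a > 0"
  obtains s1 s2 w v where "0 < s1" "s1 < s2" "g s1 = (- endpoint a, 0)" "g s2 = (return_map a, 0)"
    "arc \<phi> a (endpoint a) w" "arc (\<lambda>p. \<phi> (- p)) (endpoint a) (return_map a) v"
    "g ` {0..s1} = (\<lambda>x. (x, w x)) ` {- endpoint a..a}"
    "g ` {s1..s2} = (\<lambda>x. - (x, v x)) ` {- return_map a..endpoint a}"
proof -
  obtain s b where s: "s > 0" "b > 0" "g s = (- b, 0)" "\<And>t. 0 < t \<Longrightarrow> t < s \<Longrightarrow> snd (g t) < 0"
    using half_turn[OF g g0 a] by blast
  have "solves F g {0..s}" by (rule solves_subset[OF g]) auto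
  then obtain w where w: "arc \<phi> a b w" "(\<lambda>t. fst (g t)) ` {0..s} = {-b..a}"
    "\<And>t. t \<in> {0..s} \<Longrightarrow> w (fst (g t)) = snd (g t)"
    by (rule solution_arc[OF _ s(1) a s(2) g0 s(3,4)]) blast+
  have b: "endpoint a = b" by (rule endpoint_eq[OF w(1)])
  define h where "h = (\<lambda>t. - g (t + s))"
  have "solves F (\<lambda>t. g (t + s)) {0..}" by (rule solves_shift[OF g]) (use s in auto)
  then have h: "solves refl.F h {0..}" unfolding h_def by (rule solves_reflect)
  have h0: "h 0 = (b, 0)" using s by (simp add: h_def)
  obtain r c where r: "r > 0" "c > 0" "h r = (- c, 0)" "\<And>t. 0 < t \<Longrightarrow> t < r \<Longrightarrow> snd (h t) < 0"
    using refl.half_turn[OF h h0 s(2)] by blast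
  have "solves refl.F h {0..r}" by (rule solves_subset[OF h]) auto
  then obtain v where v: "arc (\<lambda>p. \<phi> (- p)) b c v" "(\<lambda>t. fst (h t)) ` {0..r} = {-c..b}"
    "\<And>t. t \<in> {0..r} \<Longrightarrow> v (fst (h t)) = snd (h t)"
    by (rule refl.solution_arc[OF _ r(1) s(2) r(2) h0 r(3,4)]) blast+
  have c: "return_map a = c" unfolding return_map_def b by (rule refl.endpoint_eq[OF v(1)])
  have "g t = (fst (g t), w (fst (g t)))" if "t \<in> {0..s}" for t using w(3)[OF that] by simp
  then have "g ` {0..s} = (\<lambda>t. (fst (g t), w (fst (g t)))) ` {0..s}" by (metis (no_types, lifting) image_cong)
  also have "\<dots> = (\<lambda>x. (x, w x)) ` (\<lambda>t. fst (g t)) ` {0..s}" by (simp add: image_image)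
  finally have gw: "g ` {0..s} = (\<lambda>x. (x, w x)) ` {- b..a}" unfolding w(2) .
  have "h t = (fst (h t), v (fst (h t)))" if "t \<in> {0..r}" for t using v(3)[OF that] by simp
  then have "h ` {0..r} = (\<lambda>t. (fst (h t), v (fst (h t)))) ` {0..r}" by (metis (no_types, lifting) image_cong)
  also have "\<dots> = (\<lambda>x. (x, v x)) ` (\<lambda>t. fst (h t)) ` {0..r}" by (simp add: image_image)
  finally have hv: "h ` {0..r} = (\<lambda>x. (x, v x)) ` {- c..b}" unfolding v(2) .
  have "{s..s + r} = (\<lambda>t. t + s) ` {0..r}" by (simp add: add.commute)
  then have "g ` {s..s + r} = (\<lambda>p. - p) ` h ` {0..r}" unfolding h_def image_image by (simp only: image_image minus_minus)
  then have gv: "g ` {s..s + r} = (\<lambda>x. - (x, v x)) ` {- c..b}" unfolding hv by (simp add: image_image)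
  show thesis
  proof (rule that[of s "s + r" w v])
    show "g (s + r) = (return_map a, 0)" using r(3) unfolding c h_def by (cases "g (s + r)") (simp add: add.commute)
  qed (use s r w v gw gv in \<open>simp_all add: b c\<close>)
qed

lemma return_map_pos: "a > 0 \<Longrightarrow> return_map a > 0"
  unfolding return_map_def by (intro refl.endpoint_pos endpoint_pos)

lemma return_map_scale:
  assumes "l > 1" "a > 0" "b > 0" "b \<le> l * a"
  shows "return_map b < l * return_map a"
  unfolding return_map_def
  by (intro refl.endpoint_scale endpoint_pos less_imp_le[OF endpoint_scale] assms)

lemma return_map_bounds:
  assumes "a > 0"
  shows "return_map a \<le> max a R" "min a \<rho> \<le> return_map a"
proof -
  obtain g where g: "g 0 = (a, 0)" "solves F g {0..}" using forward_solution by blast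
  obtain s where s: "s > 0" "g s = (return_map a, 0)"
    using full_turn[OF g(2,1) assms] by (metis less_trans)
  have "solves F g {0..s}" by (rule solves_subset[OF g(2)]) auto
  then show "return_map a \<le> max a R" "min a \<rho> \<le> return_map a"
    using norm_upper[of g 0 s] norm_lower[of g 0 s] s g(1) assms return_map_pos[OF assms]
    by (simp_all add: norm_Pair)
qed

text \<open>Since \<open>x' = y \<ge> - M\<close>, the abscissa needs a minimal time to fall to 0.
  This bounds the duration of each turn from below, so the turns exhaust the half-line.\<close>

lemma turn_time:
  assumes g: "solves F g {0..}" and M: "\<And>t. t \<ge> 0 \<Longrightarrow> norm (g t) \<le> M"
    and s: "s \<ge> 0" "fst (g s) \<le> 0"
  shows "fst (g 0) \<le> M * s"
proof -
  have "- fst (g s) - M * s \<le> - fst (g 0) - M * 0"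
  proof (rule deriv_nonpos_imp_le[where u="\<lambda>t. - fst (g t) - M * t", OF s(1)])
    show "continuous_on {0..s} (\<lambda>t. - fst (g t) - M * t)"
      using solves_continuous_on[OF g] by (intro continuous_intros) (auto elim: continuous_on_subset)
    fix t assume t: "0 < t" "t < s"
    have "((\<lambda>t. - fst (g t) - M * t) has_real_derivative - snd (g t) - M) (at t)"
      by (rule derivative_eq_intros solves_derivs(1)[OF g t(1)] refl)+ simp
    moreover have "- snd (g t) \<le> M"
      using norm_snd_le[of "snd (g t)" "fst (g t)"] M[of t] t unfolding prod.collapse by simp
    ultimately show "\<exists>y. ((\<lambda>t. - fst (g t) - M * t) has_real_derivative y) (at t) \<and> y \<le> 0"
      by (intro exI conjI) auto
  qed
  then show ?thesis using s by simp
qed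

text \<open>The ratio bound on the starting points passes to the second half turn by
  \<open>arc_compare\<close>, so \<open>arc_close\<close> applies to both halves. The factor
  \<open>l\<close> is quantified after the times, so one turn admits all factors.\<close>

lemma turn_close:
  assumes g: "solves F g {0..}" and g0: "g 0 = (a, 0)" and a: "a > 0"
    and arc1: "arc \<phi> c d w" and arc2: "arc (\<lambda>p. \<phi> (- p)) d e v"
    and \<Gamma>: "(\<lambda>x. (x, w x)) ` {-d..c} \<subseteq> \<Gamma>" "(\<lambda>x. - (x, v x)) ` {-e..d} \<subseteq> \<Gamma>"
  obtains s1 s2 where "0 < s1" "s1 < s2" "fst (g s1) \<le> 0" "g s2 = (return_map a, 0)"
    "\<And>l t. l > 1 \<Longrightarrow> a \<le> l * c \<Longrightarrow> c \<le> l * a \<Longrightarrow> 0 \<le> t \<Longrightarrow> t \<le> s2 \<Longrightarrow>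
       infdist (g t) \<Gamma> \<le> (l - 1) * norm (g t)"
proof -
  obtain s1 s2 w' v' where s: "0 < s1" "s1 < s2" "g s1 = (- endpoint a, 0)" "g s2 = (return_map a, 0)"
    and arc1': "arc \<phi> a (endpoint a) w'" and arc2': "arc (\<lambda>p. \<phi> (- p)) (endpoint a) (return_map a) v'"
    and img: "g ` {0..s1} = (\<lambda>x. (x, w' x)) ` {- endpoint a..a}"
    "g ` {s1..s2} = (\<lambda>x. - (x, v' x)) ` {- return_map a..endpoint a}"
    using full_turn[OF g g0 a] by blast
  have "infdist (g t) \<Gamma> \<le> (l - 1) * norm (g t)"
    if l: "l > 1" and ac: "a \<le> l * c" "c \<le> l * a" and t: "0 \<le> t" "t \<le> s2" for l t
  proof (cases "t \<le> s1")
    case True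
    then have "g t \<in> g ` {0..s1}" using t by auto
    then obtain x where x: "x \<in> {- endpoint a..a}" "g t = (x, w' x)" unfolding img by auto
    obtain x' where x': "x' \<in> {-d..c}" "dist (x, w' x) (x', w x') \<le> (l - 1) * norm (x, w' x)"
      using arc_close[OF arc1' arc1 l ac x(1)] by blast
    have "(x', w x') \<in> \<Gamma>" using \<Gamma>(1) x'(1) by auto
    then show ?thesis using infdist_le[of "(x', w x')" \<Gamma> "g t"] x'(2) x(2) by simp
  next
    case False
    then have "g t \<in> g ` {s1..s2}" using t by auto
    then obtain x where x: "x \<in> {- return_map a..endpoint a}" "g t = - (x, v' x)" unfolding img by auto
    have "endpoint a \<le> l * d" "d \<le> l * endpoint a"
      using arc_compare(1)[OF arc1 arc1' l ac(1)] arc_compare(1)[OF arc1' arc1 l ac(2)] by auto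
    then obtain x' where x': "x' \<in> {-e..d}" "dist (x, v' x) (x', v x') \<le> (l - 1) * norm (x, v' x)"
      using refl.arc_close[OF arc2' arc2 l _ _ x(1)] by blast
    have "- (x', v x') \<in> \<Gamma>" using \<Gamma>(2) x'(1) by auto
    moreover have "dist (g t) (- (x', v x')) = dist (x, v' x) (x', v x')"
      unfolding x(2) by (simp only: dist_minus)
    moreover have "norm (g t) = norm (x, v' x)" unfolding x(2) by (rule norm_minus_cancel)
    ultimately show ?thesis using infdist_le[of "- (x', v x')" \<Gamma> "g t"] x'(2) by simp
  qed
  then show thesis using that[of s1 s2] s endpoint_pos[OF a] by auto
qed

lemma orbit_attracted:
  assumes c: "c > 0" and lim: "(\<lambda>n. (return_map ^^ n) a) \<longlonglongrightarrow> c"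
    and arc1: "arc \<phi> c d w" and arc2: "arc (\<lambda>p. \<phi> (- p)) d e v"
    and \<Gamma>: "(\<lambda>x. (x, w x)) ` {-d..c} \<subseteq> \<Gamma>" "(\<lambda>x. - (x, v x)) ` {-e..d} \<subseteq> \<Gamma>"
    and g: "solves F g {0..}" and g0: "g 0 = (a, 0)" and a: "a > 0"
  shows "((\<lambda>t. infdist (g t) \<Gamma>) \<longlongrightarrow> 0) at_top"
proof -
  let ?a = "\<lambda>n. (return_map ^^ n) a"
  have apos: "?a n > 0" for n by (induction n) (use a return_map_pos in auto)
  have "g 0 \<noteq> 0" using g0 a by (simp add: zero_prod_def)
  then obtain m M where m: "0 < m" and mn: "\<And>t. t \<ge> 0 \<Longrightarrow> m \<le> norm (g t)" and Mn: "\<And>t. t \<ge> 0 \<Longrightarrow> norm (g t) \<le> M"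
    using orbit_bounds[OF g] by blast
  have M0: "M > 0" using m mn[of 0] Mn[of 0] by simp
  \<comment> \<open>For each turn this records its minimal duration and the distance estimate for
    every admissible factor, so one sequence of crossing times serves all
    \<open>\<epsilon>\<close>.\<close>
  let ?Q = "\<lambda>n t t'. t + m / M \<le> t' \<and> (\<forall>l s. l > 1 \<longrightarrow> ?a n \<le> l * c \<longrightarrow> c \<le> l * ?a n \<longrightarrow>
     t \<le> s \<longrightarrow> s \<le> t' \<longrightarrow> infdist (g s) \<Gamma> \<le> (l - 1) * norm (g s))"
  have "\<exists>\<tau>. \<forall>n. (\<tau> n \<ge> 0 \<and> g (\<tau> n) = (?a n, 0)) \<and> ?Q n (\<tau> n) (\<tau> (Suc n))"
  proof (rule dependent_nat_choice)
    show "\<exists>t\<ge>0. g t = (?a 0, 0)" using g0 by auto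
    fix t n assume t: "t \<ge> 0 \<and> g t = (?a n, 0)"
    let ?h = "\<lambda>s. g (s + t)"
    have h: "solves F ?h {0..}" by (rule solves_shift[OF g]) (use t in auto)
    have h0: "?h 0 = (?a n, 0)" using t by simp
    obtain s1 s2 where s: "0 < s1" "s1 < s2" "fst (?h s1) \<le> 0" "?h s2 = (return_map (?a n), 0)"
      and close: "\<And>l r. l > 1 \<Longrightarrow> ?a n \<le> l * c \<Longrightarrow> c \<le> l * ?a n \<Longrightarrow> 0 \<le> r \<Longrightarrow> r \<le> s2 \<Longrightarrow>
       infdist (?h r) \<Gamma> \<le> (l - 1) * norm (?h r)"
      using turn_close[OF h h0 apos arc1 arc2 \<Gamma>] by metis
    have "m \<le> ?a n" using mn[of t] t apos[of n] by (simp add: norm_Pair)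
    also have "\<dots> \<le> M * s1"
      using turn_time[OF h, of M s1] Mn s t by simp
    finally have "m / M \<le> s1" using M0 by (simp add: field_simps)
    then have "t + m / M \<le> t + s2" using s by simp
    moreover have "infdist (g s) \<Gamma> \<le> (l - 1) * norm (g s)"
      if "l > 1" "?a n \<le> l * c" "c \<le> l * ?a n" "t \<le> s" "s \<le> t + s2" for l s
      using close[of l "s - t"] that by simp
    moreover have "g (t + s2) = (?a (Suc n), 0)" using s(4) by (simp add: add.commute)
    ultimately show "\<exists>t'. (t' \<ge> 0 \<and> g t' = (?a (Suc n), 0)) \<and> ?Q n t t'"
      using t s by (intro exI[of _ "t + s2"]) auto
  qed
  then obtain \<tau> where \<tau>: "\<And>n. \<tau> n \<ge> 0" "\<And>n. \<tau> n + m / M \<le> \<tau> (Suc n)"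
    and close: "\<And>n l s. l > 1 \<Longrightarrow> ?a n \<le> l * c \<Longrightarrow> c \<le> l * ?a n \<Longrightarrow>
     \<tau> n \<le> s \<Longrightarrow> s \<le> \<tau> (Suc n) \<Longrightarrow> infdist (g s) \<Gamma> \<le> (l - 1) * norm (g s)" by metis
  have \<delta>: "m / M > 0" using m M0 by simp
  have "incseq \<tau>" using \<tau>(2) \<delta> by (intro incseq_SucI) (smt (verit))
  have \<tau>n: "real n * (m / M) \<le> \<tau> n" for n
  proof (induction n)
    case (Suc n)
    have "real (Suc n) * (m / M) = real n * (m / M) + m / M" by (simp add: algebra_simps)
    then show ?case using Suc \<tau>(2)[of n] by linarith
  qed (simp add: \<tau>)
  show ?thesis
  proof (rule tendstoI)
    fix \<epsilon> :: real assume \<epsilon>: "\<epsilon> > 0"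
    \<comment> \<open>Chosen so that \<open>(l - 1) * M\<close> equals
      \<open>\<epsilon> / 2\<close>.\<close>
    define l where "l = 1 + \<epsilon> / (2 * M)"
    have l: "l > 1" "(l - 1) * M < \<epsilon>" using \<epsilon> M0 by (auto simp: l_def)
    have "c < l * c" "c / l < c" using l(1) c by (auto simp: field_simps)
    then have "\<forall>\<^sub>F n in sequentially. ?a n < l * c \<and> c / l < ?a n"
      using order_tendstoD[OF lim] by (auto intro: eventually_conj)
    then obtain N where N: "\<And>n. n \<ge> N \<Longrightarrow> ?a n < l * c \<and> c / l < ?a n"
      by (auto simp: eventually_sequentially)
    have "dist (infdist (g t) \<Gamma>) 0 < \<epsilon>" if t: "t \<ge> \<tau> N" for t
    proof -
      obtain k where "t < real k * (m / M)" using reals_Archimedean3[OF \<delta>] by blast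
      then have ex: "t < \<tau> k" using \<tau>n[of k] by linarith
      \<comment> \<open>The first crossing after \<open>t\<close>; its predecessor \<open>n\<close>
        is the turn in progress, and \<open>n \<ge> N\<close> because
        \<open>t \<ge> \<tau> N\<close>.\<close>
      define K where "K = (LEAST k. t < \<tau> k)"
      have K: "t < \<tau> K" unfolding K_def by (rule LeastI[where P="\<lambda>k. t < \<tau> k", OF ex])
      have "K > N" using K t incseqD[OF \<open>incseq \<tau>\<close>, of K N] by force
      then obtain n where n: "K = Suc n" "n \<ge> N" by (cases K) auto
      have "\<tau> n \<le> t" using not_less_Least[of n "\<lambda>k. t < \<tau> k"] n(1) unfolding K_def by simp
      have "?a n \<le> l * c" "c \<le> l * ?a n" using N[OF n(2)] l(1) by (auto simp: field_simps)
      then have "infdist (g t) \<Gamma> \<le> (l - 1) * norm (g t)"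
        using close[OF l(1), of n t] \<open>\<tau> n \<le> t\<close> K n(1) by simp
      also have "\<dots> \<le> (l - 1) * M" using Mn[of t] t \<tau>(1)[of N] l(1) by (intro mult_left_mono) auto
      finally show ?thesis using l(2) infdist_nonneg[of "g t" \<Gamma>] by simp
    qed
    then show "\<forall>\<^sub>F t in at_top. dist (infdist (g t) \<Gamma>) 0 < \<epsilon>"
      by (auto simp: eventually_at_top_linorder)
  qed
qed

text \<open>A negative time is moved into the half-line by adding enough periods; by forward
  uniqueness the value does not depend on how many.\<close>

lemma periodic_extension:
  assumes g: "solves F g {0..}" and T: "T > 0" and per: "g T = g 0"
  obtains \<gamma> where "solution_on F UNIV \<gamma>" "\<And>t. \<gamma> (t + T) = \<gamma> t" "\<And>t. t \<ge> 0 \<Longrightarrow> \<gamma> t = g t"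
proof -
  have shift: "g (t + T) = g t" if t: "t \<ge> 0" for t
  proof (rule solves_unique_forward[of _ 0])
    show "solves F (\<lambda>t. g (t + T)) {0..t}" by (rule solves_shift[OF g]) (use T in auto)
    show "solves F g {0..t}" by (rule solves_subset[OF g]) auto
  qed (use t per in auto)
  have shifts: "g (t + real n * T) = g t" if "t \<ge> 0" for t n
  proof (induction n)
    case (Suc n)
    have "t + real (Suc n) * T = (t + real n * T) + T" by (simp add: algebra_simps)
    then have "g (t + real (Suc n) * T) = g ((t + real n * T) + T)" by (rule arg_cong)
    also have "\<dots> = g (t + real n * T)" by (rule shift) (use that T in simp)
    finally show ?case using Suc by simp
  qed simp
  define N where "N t = nat \<lceil>\<bar>t\<bar> / T\<rceil>" for t
  define \<gamma> where "\<gamma> t = g (t + real (N t) * T)" for t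
  have N: "t + real (N t) * T \<ge> 0" for t
  proof -
    have "\<bar>t\<bar> / T \<le> real (N t)" unfolding N_def by linarith
    then have "\<bar>t\<bar> \<le> real (N t) * T" using T by (simp add: field_simps)
    then show ?thesis by linarith
  qed
  have eq: "g (t + real n * T) = g (t + real k * T)" if "t + real n * T \<ge> 0" "n \<le> k" for t n k
    using shifts[OF that(1), of "k - n"] that(2) by (simp add: of_nat_diff algebra_simps)
  have \<gamma>: "\<gamma> t = g (t + real n * T)" if "t + real n * T \<ge> 0" for t n
    unfolding \<gamma>_def using eq[OF that] eq[OF N] by (metis nat_le_linear)
  have "\<gamma> (t + T) = \<gamma> t" for t
  proof -
    have "\<gamma> (t + T) = g (t + T + real (N t) * T)" by (rule \<gamma>) (use N[of t] T in linarith)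
    also have "\<dots> = \<gamma> t"
      using \<gamma>[of t "Suc (N t)"] N[of t] T by (simp add: algebra_simps)
    finally show ?thesis .
  qed
  moreover have "\<gamma> t = g t" if "t \<ge> 0" for t using \<gamma>[of t 0] that by simp
  moreover have "solution_on F UNIV \<gamma>"
    unfolding solution_on_def
  proof (intro conjI ballI)
    fix t :: real
    \<comment> \<open>One period more than \<open>N t\<close> makes \<open>t + r\<close> strictly
      positive, so the derivative at \<open>t\<close> is two-sided.\<close>
    define r where "r = real (Suc (N t)) * T"
    have tr: "t + r > 0" using N[of t] T by (simp add: r_def algebra_simps)
    have eqr: "g (s + r) = \<gamma> s" if "s \<in> {-r<..}" for s
      using \<gamma>[of s "Suc (N t)"] that by (simp add: r_def)
    have "solves F (\<lambda>s. g (s + r)) {-r<..}" by (rule solves_shift[OF g]) auto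
    then have "((\<lambda>s. g (s + r)) has_vector_derivative F (g (t + r))) (at t)"
      by (rule solves_at) (use tr in \<open>auto simp: interior_open\<close>)
    then show "(\<gamma> has_vector_derivative F (\<gamma> t)) (at t)"
      using has_vector_derivative_transform_within_open[of _ _ t "{-r<..}" \<gamma>] eqr tr by auto
  qed auto
  ultimately show thesis by (rule that[rotated])
qed

text \<open>The closed orbit starts at the fixed point of the return map. Attraction is stated for
  forward solutions, so it applies both to maximal solutions and to any competing periodic
  orbit.\<close>

lemma attracting_cycle:
  obtains \<gamma> T where "solution_on F UNIV \<gamma>" "T > 0" "\<And>t. \<gamma> (t + T) = \<gamma> t" "\<not> \<gamma> constant_on UNIV"
    "\<And>g. solves F g {0..} \<Longrightarrow> g 0 \<noteq> 0 \<Longrightarrow> ((\<lambda>t. infdist (g t) (range \<gamma>)) \<longlongrightarrow> 0) at_top"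
proof -
  obtain c where c: "c > 0" "return_map c = c"
    and lim: "\<And>a. a > 0 \<Longrightarrow> (\<lambda>n. (return_map ^^ n) a) \<longlonglongrightarrow> c"
    using sublinear_map_attracting_fixpoint[of return_map R \<rho>]
      return_map_pos return_map_scale return_map_bounds \<rho>_pos by blast
  obtain g where g: "g 0 = (c, 0)" "solves F g {0..}" using forward_solution by blast
  obtain s T w v where s: "0 < s" "s < T" "g s = (- endpoint c, 0)" "g T = (return_map c, 0)"
    and arcs: "arc \<phi> c (endpoint c) w" "arc (\<lambda>p. \<phi> (- p)) (endpoint c) (return_map c) v"
    and img: "g ` {0..s} = (\<lambda>x. (x, w x)) ` {- endpoint c..c}"
    "g ` {s..T} = (\<lambda>x. - (x, v x)) ` {- return_map c..endpoint c}"
    using full_turn[OF g(2,1) c(1)] by blast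
  obtain \<gamma> where \<gamma>: "solution_on F UNIV \<gamma>" "\<And>t. \<gamma> (t + T) = \<gamma> t" "\<And>t. t \<ge> 0 \<Longrightarrow> \<gamma> t = g t"
    using periodic_extension[OF g(2), of T] s c g(1) by auto
  have sub: "g ` {r..u} \<subseteq> range \<gamma>" if "r \<ge> 0" for r u
  proof
    fix p assume "p \<in> g ` {r..u}"
    then obtain t where t: "t \<in> {r..u}" "p = g t" by blast
    then have "p = \<gamma> t" using \<gamma>(3)[of t] that by auto
    then show "p \<in> range \<gamma>" by blast
  qed
  have sub1: "(\<lambda>x. (x, w x)) ` {- endpoint c..c} \<subseteq> range \<gamma>"
    and sub2: "(\<lambda>x. - (x, v x)) ` {- return_map c..endpoint c} \<subseteq> range \<gamma>"
    using sub[of 0 s] sub[of s T] s unfolding img by auto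
  show thesis
  proof (rule that[OF \<gamma>(1) _ \<gamma>(2)])
    show "T > 0" using s by simp
    \<comment> \<open>The orbit meets the axis on both sides of the origin.\<close>
    show "\<not> \<gamma> constant_on UNIV"
    proof
      assume "\<gamma> constant_on UNIV"
      then have "\<gamma> 0 = \<gamma> s" by (auto simp: constant_on_def)
      then show False using \<gamma>(3)[of 0] \<gamma>(3)[of s] s g(1) c endpoint_pos[OF c(1)] by simp
    qed
    fix h assume h: "solves F h {0..}" "h 0 \<noteq> 0"
    obtain t a where t: "t \<ge> 0" "a > 0" "h t = (a, 0)" using crosses_positive_axis[OF h] by blast
    have "solves F (\<lambda>r. h (r + t)) {0..}" by (rule solves_shift[OF h(1)]) (use t in auto)
    then have "((\<lambda>r. infdist (h (r + t)) (range \<gamma>)) \<longlongrightarrow> 0) at_top"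
      by (rule orbit_attracted[where g="\<lambda>r. h (r + t)", OF c(1) lim[OF t(2)] arcs sub1 sub2])
         (simp_all add: t)
    then show "((\<lambda>t. infdist (h t) (range \<gamma>)) \<longlongrightarrow> 0) at_top"
      by (rule tendsto_at_top_shift)
  qed
qed

text \<open>Gluing the global forward solution from \<open>\<gamma> t1\<close> to
  \<open>\<gamma>\<close> yields an extension, so maximality forces \<open>I\<close> to contain all
  later times.\<close>

lemma maximal_forward:
  assumes max: "maximal_solution_on F I \<gamma>" and nc: "\<not> \<gamma> constant_on I"
  obtains t1 where "{t1..} \<subseteq> I" "\<gamma> t1 \<noteq> 0" "solves F (\<lambda>t. \<gamma> (t + t1)) {0..}"
proof -
  have sol: "solution_on F I \<gamma>" using max by (simp add: maximal_solution_on_def)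
  then have I: "open I" "is_interval I" and der: "\<And>t. t \<in> I \<Longrightarrow> (\<gamma> has_vector_derivative F (\<gamma> t)) (at t)"
    by (auto simp: solution_on_def)
  obtain t1 where t1: "t1 \<in> I" "\<gamma> t1 \<noteq> 0" using nc unfolding constant_on_def by blast
  have solv: "solves F \<gamma> S" if "S \<subseteq> I" for S
    unfolding solves_def using der that by (blast intro: has_vector_derivative_at_within)
  obtain h where h: "h 0 = \<gamma> t1" "solves F h {0..}" using forward_solution by blast
  define \<delta> where "\<delta> = (\<lambda>t. h (t - t1))"
  have \<delta>: "solves F \<delta> {t1..}"
    unfolding \<delta>_def using solves_shift[OF h(2), of "{t1..}" "- t1"] by simp
  have eq: "\<gamma> t = \<delta> t" if t: "t \<in> I" "t \<ge> t1" for t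
  proof (rule solves_unique_forward[of _ t1])
    show "solves F \<gamma> {t1..t}" 
      using mem_is_interval_1_I[OF I(2) t1(1) t(1)] by (intro solv) auto
    show "solves F \<delta> {t1..t}" by (rule solves_subset[OF \<delta>]) auto
  qed (use t h in \<open>auto simp: \<delta>_def\<close>)
  \<comment> \<open>The two pieces agree on their overlap by forward uniqueness, so the definition
    by cases is differentiable everywhere.\<close>
  define \<Delta> where "\<Delta> = (\<lambda>t. if t \<in> I then \<gamma> t else \<delta> t)"
  have "solution_on F (I \<union> {t1<..}) \<Delta>"
    unfolding solution_on_def
  proof (intro conjI ballI)
    show "open (I \<union> {t1<..})" using I by auto
    show "I \<union> {t1<..} \<noteq> {}" by auto
    show "is_interval (I \<union> {t1<..})"
      unfolding is_interval_1
    proof (intro ballI allI impI)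
      fix a b x assume ab: "a \<in> I \<union> {t1<..}" "b \<in> I \<union> {t1<..}" "a \<le> x \<and> x \<le> b"
      show "x \<in> I \<union> {t1<..}"
      proof (cases "x > t1")
        case False
        then have "a \<in> I" using ab by auto
        then show ?thesis using mem_is_interval_1_I[OF I(2) _ t1(1), of a x] ab False by auto
      qed auto
    qed
    fix t assume t: "t \<in> I \<union> {t1<..}"
    show "(\<Delta> has_vector_derivative F (\<Delta> t)) (at t)"
    proof (cases "t \<in> I")
      case True
      have "(\<Delta> has_vector_derivative F (\<gamma> t)) (at t)"
        by (rule has_vector_derivative_transform_within_open[OF der[OF True] I(1) True]) (simp add: \<Delta>_def)
      then show ?thesis using True by (simp add: \<Delta>_def)
    next
      case False
      then have tt: "t > t1" using t by auto
      have "(\<delta> has_vector_derivative F (\<delta> t)) (at t)"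
        by (rule solves_at[OF \<delta>]) (use tt in simp)
      then have "(\<Delta> has_vector_derivative F (\<delta> t)) (at t)"
        by (rule has_vector_derivative_transform_within_open[of _ _ _ "{t1<..}"]) (use tt eq in \<open>auto simp: \<Delta>_def\<close>)
      then show ?thesis using False by (simp add: \<Delta>_def)
    qed
  qed
  moreover have "J = I" if "solution_on F J d" "I \<subseteq> J" "\<And>t. t \<in> I \<Longrightarrow> d t = \<gamma> t" for J d
    using conjunct2[OF max[unfolded maximal_solution_on_def], rule_format, of J d] that by simp
  ultimately have "I \<union> {t1<..} = I" by (simp add: \<Delta>_def)
  then have "{t1<..} \<subseteq> I" by blast
  moreover have "{t1..} = insert t1 {t1<..}" by auto
  ultimately have sub: "{t1..} \<subseteq> I" using t1(1) by simp
  have "solves F (\<lambda>t. \<gamma> (t + t1)) {0..}" by (rule solves_shift[OF solv[OF sub]]) auto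
  then show thesis by (rule that[OF sub t1(2)])
qed

end

section \<open>Limit cycles\<close>

lemma periodic_int_shift:
  fixes f :: "real \<Rightarrow> 'a"
  assumes "\<And>t. f (t + T) = f t"
  shows "f (t + of_int k * T) = f t"
proof -
  have n: "f (t + real n * T) = f t" for t n
  proof (induction n)
    case (Suc n)
    have "t + real (Suc n) * T = (t + real n * T) + T" by (simp add: algebra_simps)
    then show ?case using assms[of "t + real n * T"] Suc by metis
  qed simp
  show ?thesis
  proof (cases "k \<ge> 0")
    case True
    then show ?thesis using n[of t "nat k"] by simp
  next
    case False
    then show ?thesis using n[of "t + of_int k * T" "nat (- k)"] by simp
  qed
qed

text \<open>Any starting time \<open>c\<close> is allowed, so forward uniqueness from one common
  point determines the whole closed orbit.\<close>

lemma periodic_range: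
  fixes f :: "real \<Rightarrow> 'a"
  assumes per: "\<And>t. f (t + T) = f t" and T: "T > 0"
  shows "range f = f ` {c..c + T}"
proof (intro equalityI subsetI)
  fix p assume "p \<in> range f"
  then obtain t where p: "p = f t" by blast
  let ?k = "\<lfloor>(t - c) / T\<rfloor>"
  have "of_int ?k \<le> (t - c) / T" "(t - c) / T < of_int ?k + 1" by linarith+
  then have "of_int ?k * T \<le> t - c" "t - c < (of_int ?k + 1) * T" 
    by (simp_all only: pos_le_divide_eq[OF T] pos_divide_less_eq[OF T])
  then have "t + of_int (- ?k) * T \<in> {c..c + T}" by (simp add: algebra_simps)
  moreover have "f (t + of_int (- ?k) * T) = p" using periodic_int_shift[of f T t "- ?k", OF per] p by simp
  ultimately show "p \<in> f ` {c..c + T}" by (metis imageI)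
qed auto

context star_damping
begin

lemma solution_on_UNIV_solves: "solution_on F UNIV \<gamma> \<Longrightarrow> solves F \<gamma> S"
  unfolding solves_def solution_on_def by (blast intro: has_vector_derivative_at_within)

text \<open>A second cycle is attracted by the first, but along one of its points, revisited in
  every period, the distance is constant, hence 0. The cycles thus share a point and coincide by
  forward uniqueness and periodicity.\<close>

lemma unique_attracting_limit_cycle:
  "\<exists>!\<Gamma>. limit_cycle F \<Gamma>"
  "limit_cycle F \<Gamma> \<Longrightarrow> maximal_solution_on F I \<gamma> \<Longrightarrow> \<not> \<gamma> constant_on I \<Longrightarrow> attracts \<Gamma> I \<gamma>"
proof -
  obtain \<beta> T where \<beta>: "solution_on F UNIV \<beta>" "T > 0" "\<And>t. \<beta> (t + T) = \<beta> t" "\<not> \<beta> constant_on UNIV"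
    and attr: "\<And>g. solves F g {0..} \<Longrightarrow> g 0 \<noteq> 0 \<Longrightarrow> ((\<lambda>t. infdist (g t) (range \<beta>)) \<longlongrightarrow> 0) at_top"
    using attracting_cycle by blast
  have lc: "limit_cycle F (range \<beta>)" unfolding limit_cycle_def using \<beta> by blast
  have "compact (range \<beta>)"
    unfolding periodic_range[of \<beta> T 0, OF \<beta>(3,2)]
    by (intro compact_continuous_image solves_continuous_on[of F] solution_on_UNIV_solves \<beta>) auto
  then have closed: "closed (range \<beta>)" by (rule compact_imp_closed)
  have uniq: "\<Gamma> = range \<beta>" if "limit_cycle F \<Gamma>" for \<Gamma>
  proof -
    obtain \<delta> S where \<delta>: "solution_on F UNIV \<delta>" "S > 0" "\<And>t. \<delta> (t + S) = \<delta> t" "\<not> \<delta> constant_on UNIV"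
      and \<Gamma>: "\<Gamma> = range \<delta>" using \<open>limit_cycle F \<Gamma>\<close> unfolding limit_cycle_def by blast
    obtain u where u: "\<delta> u \<noteq> 0" using \<delta>(4) unfolding constant_on_def by blast
    have "solves F (\<lambda>t. \<delta> (t + u)) {0..}"
      by (rule solves_shift[of _ _ UNIV]) (auto intro: solution_on_UNIV_solves \<delta>)
    then have "((\<lambda>t. infdist (\<delta> (t + u)) (range \<beta>)) \<longlongrightarrow> 0) at_top"
      by (rule attr) (use u in simp)
    then have lim: "((\<lambda>t. infdist (\<delta> t) (range \<beta>)) \<longlongrightarrow> 0) at_top" by (rule tendsto_at_top_shift)
    have "filterlim (\<lambda>n. u + real n * S) at_top sequentially"
      by (intro filterlim_tendsto_add_at_top[OF tendsto_const]
          filterlim_at_top_mult_tendsto_pos[OF tendsto_const \<delta>(2)] filterlim_real_sequentially)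
    from filterlim_compose[OF lim this]
    have "(\<lambda>n. infdist (\<delta> (u + real n * S)) (range \<beta>)) \<longlonglongrightarrow> 0" .
    moreover have "\<delta> (u + real n * S) = \<delta> u" for n
      using periodic_int_shift[of \<delta> S u "int n", OF \<delta>(3)] by simp
    ultimately have "infdist (\<delta> u) (range \<beta>) = 0" by (simp add: LIMSEQ_const_iff)
    then have "\<delta> u \<in> range \<beta>" using in_closed_iff_infdist_zero[OF closed] by blast
    then obtain v where v: "\<delta> u = \<beta> v" by blast
    have eq: "\<delta> (t + u) = \<beta> (t + v)" if "t \<ge> 0" for t
    proof (rule solves_unique_forward[of "\<lambda>t. \<delta> (t + u)" 0 t "\<lambda>t. \<beta> (t + v)"])
      show "solves F (\<lambda>t. \<delta> (t + u)) {0..t}" "solves F (\<lambda>t. \<beta> (t + v)) {0..t}"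
        by (rule solves_shift[of _ _ UNIV]; auto intro: solution_on_UNIV_solves \<delta> \<beta>)+
    qed (use that v in auto)
    have "range \<delta> \<subseteq> range \<beta>"
      unfolding periodic_range[of \<delta> S u, OF \<delta>(3,2)]
    proof
      fix p assume "p \<in> \<delta> ` {u..u + S}"
      then obtain t where "t \<ge> u" "p = \<delta> t" by auto
      then show "p \<in> range \<beta>" using eq[of "t - u"] by auto
    qed
    moreover have "range \<beta> \<subseteq> range \<delta>"
      unfolding periodic_range[of \<beta> T v, OF \<beta>(3,2)]
    proof
      fix p assume "p \<in> \<beta> ` {v..v + T}"
      then obtain t where "t \<ge> v" "p = \<beta> t" by auto
      then show "p \<in> range \<delta>" using eq[of "t - v"] by (metis diff_add_cancel diff_ge_0_iff_ge rangeI)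
    qed
    ultimately show ?thesis using \<Gamma> by simp
  qed
  show "\<exists>!\<Gamma>. limit_cycle F \<Gamma>" using lc uniq by blast
  assume "limit_cycle F \<Gamma>" and max: "maximal_solution_on F I \<gamma>" and nc: "\<not> \<gamma> constant_on I"
  then have \<Gamma>: "\<Gamma> = range \<beta>" by (intro uniq)
  obtain t1 where t1: "{t1..} \<subseteq> I" "\<gamma> t1 \<noteq> 0" "solves F (\<lambda>t. \<gamma> (t + t1)) {0..}"
    using maximal_forward[OF max nc] by blast
  have "((\<lambda>t. infdist (\<gamma> (t + t1)) \<Gamma>) \<longlongrightarrow> 0) at_top"
    unfolding \<Gamma> by (rule attr[OF t1(3)]) (use t1(2) in simp)
  then have "((\<lambda>t. infdist (\<gamma> t) \<Gamma>) \<longlongrightarrow> 0) at_top" by (rule tendsto_at_top_shift)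
  moreover have "\<forall>\<^sub>F t in at_top. t \<in> I"
    using eventually_ge_at_top[of t1] by eventually_elim (use t1(1) in auto)
  ultimately show "attracts \<Gamma> I \<gamma>" unfolding attracts_def by blast
qed

end

section \<open>From the differentiability and star-shape hypotheses to the abstract setting\<close>

lemma C1_plane_has_derivative:
  assumes "C1_plane f"
  shows "(f has_derivative (\<lambda>h. fst h * partial_x f p + snd h * partial_y f p)) (at p)"
proof -
  obtain x y where p: "p = (x, y)" by (cases p)
  have fx: "((\<lambda>s. f (s, y)) has_real_derivative partial_x f (x, y)) (at x)" for x y
    using assms unfolding C1_plane_def partial_x_def
    by (simp add: DERIV_deriv_iff_real_differentiable)
  have fy: "((\<lambda>s. f (x, s)) has_real_derivative partial_y f (x, y)) (at y)" for x y
    using assms unfolding C1_plane_def partial_y_def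
    by (simp add: DERIV_deriv_iff_real_differentiable)
  have "((\<lambda>(x, y). f (x, y)) has_derivative
      (\<lambda>(tx, ty). partial_x f (x, y) * tx + blinfun_apply (blinfun_scaleR_left (partial_y f (x, y))) ty))
      (at (x, y) within UNIV \<times> UNIV)"
  \<comment> \<open>The partial derivative in \<open>y\<close> is packed as a bounded linear map
    because its continuity is required in operator norm.\<close>
  proof (rule has_derivative_partialsI[where f="\<lambda>x y. f (x, y)" and fy="\<lambda>x y. blinfun_scaleR_left (partial_y f (x, y))"])
    show "((\<lambda>x. f (x, y)) has_derivative (*) (partial_x f (x, y))) (at x within UNIV)"
      using fx[of y x] by (simp add: has_field_derivative_def)
    show "((\<lambda>y. f (x, y)) has_derivative blinfun_apply (blinfun_scaleR_left (partial_y f (x, y)))) (at y within UNIV)" for x y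
    proof -
      have "blinfun_apply (blinfun_scaleR_left (partial_y f (x, y))) = (*) (partial_y f (x, y))"
        by (rule ext) (simp add: mult.commute)
      then show ?thesis using fy[of x y] by (simp add: has_field_derivative_def)
    qed
    have "continuous_on UNIV (partial_y f)" using assms by (simp add: C1_plane_def)
    then have "isCont (partial_y f) (x, y)" by (simp add: continuous_on_eq_continuous_at)
    then have "isCont (\<lambda>p. blinfun_scaleR_left (partial_y f p) :: real \<Rightarrow>\<^sub>L real) (x, y)"
      by (rule bounded_linear.isCont[OF bounded_linear_blinfun_scaleR_left])
    then show "continuous (at (x, y) within UNIV \<times> UNIV) (\<lambda>(x, y). blinfun_scaleR_left (partial_y f (x, y)) :: real \<Rightarrow>\<^sub>L real)"
      by (simp add: split_beta')
  qed auto
  moreover have "(\<lambda>(x, y). f (x, y)) = f" by auto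
  moreover have "(\<lambda>(tx, ty). partial_x f (x, y) * tx + blinfun_apply (blinfun_scaleR_left (partial_y f (x, y))) ty)
      = (\<lambda>h. fst h * partial_x f p + snd h * partial_y f p)"
    by (auto simp: p mult.commute)
  ultimately show ?thesis by (simp add: p)
qed

lemma C1_plane_lipschitz:
  assumes "C1_plane f"
  shows "\<exists>L>0. \<forall>p\<in>cball 0 M. \<forall>q\<in>cball 0 M. \<bar>f p - f q\<bar> \<le> L * norm (p - q)"
proof -
  let ?k = "\<lambda>p. \<bar>partial_x f p\<bar> + \<bar>partial_y f p\<bar>"
  have "continuous_on (cball 0 M) ?k"
    using assms unfolding C1_plane_def
    by (intro continuous_intros) (auto elim: continuous_on_subset)
  then have "bounded (?k ` cball 0 M)" by (intro compact_imp_bounded compact_continuous_image) auto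
  then obtain L where L: "L > 0" "\<And>p. p \<in> cball 0 M \<Longrightarrow> ?k p \<le> L"
    using bounded_pos[of "?k ` cball 0 M"] by force
  have "norm (f p - f q) \<le> L * norm (p - q)" if "p \<in> cball 0 M" "q \<in> cball 0 M" for p q
  proof (rule differentiable_bound[where S="cball 0 M"])
    fix x :: "real \<times> real" assume x: "x \<in> cball 0 M"
    show "(f has_derivative (\<lambda>h. fst h * partial_x f x + snd h * partial_y f x)) (at x within cball 0 M)"
      by (rule has_derivative_at_withinI[OF C1_plane_has_derivative[OF assms]])
    show "onorm (\<lambda>h. fst h * partial_x f x + snd h * partial_y f x) \<le> L"
    proof (rule onorm_le)
      fix h :: "real \<times> real"
      have "\<bar>fst h\<bar> \<le> norm h" "\<bar>snd h\<bar> \<le> norm h"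
        using norm_fst_le[of "fst h" "snd h"] norm_snd_le[of "snd h" "fst h"] unfolding prod.collapse by auto
      then have "\<bar>fst h * partial_x f x\<bar> + \<bar>snd h * partial_y f x\<bar> \<le> norm h * ?k x"
        unfolding abs_mult distrib_left by (intro add_mono mult_right_mono) auto
      also have "\<dots> \<le> norm h * L" by (intro mult_left_mono L x) auto
      finally show "norm (fst h * partial_x f x + snd h * partial_y f x) \<le> L * norm h"
        by (simp add: mult.commute)
    qed
  qed (use that in auto)
  then show ?thesis using L(1) by auto
qed

text \<open>A nonvanishing radial derivative makes \<open>f\<close> injective along the ray, hence
  monotone by continuity; the negative value at the origin and the nonnegative values far out decide
  that it increases.\<close>

lemma star_shaped_radial_increasing:
  fixes f :: "real \<times> real \<Rightarrow> real"
  assumes C1: "C1_plane f" and star: "strictly_star_shaped f"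
    and outer: "\<And>p. norm p \<ge> R \<Longrightarrow> f p \<ge> 0" and neg: "f 0 < 0"
    and p: "p \<noteq> 0" and s: "s > 1"
  shows "f p < f (s *\<^sub>R p)"
proof -
  define g where "g = (\<lambda>r. f (r *\<^sub>R p))"
  define D where "D = (\<lambda>r. fst p * partial_x f (r *\<^sub>R p) + snd p * partial_y f (r *\<^sub>R p))"
  have der: "(g has_real_derivative D r) (at r)" for r
  proof -
    have "((\<lambda>r. r *\<^sub>R p) has_derivative (\<lambda>h. h *\<^sub>R p)) (at r)" by (auto intro!: derivative_eq_intros)
    from has_derivative_compose[OF this C1_plane_has_derivative[OF C1]]
    have "(g has_derivative (\<lambda>h. fst (h *\<^sub>R p) * partial_x f (r *\<^sub>R p) + snd (h *\<^sub>R p) * partial_y f (r *\<^sub>R p))) (at r)"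
      by (simp add: g_def)
    also have "(\<lambda>h. fst (h *\<^sub>R p) * partial_x f (r *\<^sub>R p) + snd (h *\<^sub>R p) * partial_y f (r *\<^sub>R p)) = (*) (D r)"
      by (rule ext) (simp add: D_def algebra_simps)
    finally show ?thesis by (simp add: has_field_derivative_def)
  qed
  have D0: "D r \<noteq> 0" if "r > 0" for r
  proof
    assume "D r = 0"
    \<comment> \<open>The product \<open>r * D r\<close> is the expression in
      \<open>strictly_star_shaped\<close> at the point \<open>r *\<^sub>R p\<close>.\<close>
    then have "r * D r = 0" by simp
    then have "fst (r *\<^sub>R p) * partial_x f (r *\<^sub>R p) + snd (r *\<^sub>R p) * partial_y f (r *\<^sub>R p) = 0"
      by (simp add: D_def algebra_simps)
    moreover have "(fst (r *\<^sub>R p), snd (r *\<^sub>R p)) \<noteq> (0, 0)"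
      using p that by (auto simp: prod_eq_iff)
    ultimately show False
      using star unfolding strictly_star_shaped_def by (metis prod.collapse)
  qed
  have cg: "continuous_on S g" for S
    using der by (meson DERIV_isCont continuous_at_imp_continuous_on)
  have ne: "g r \<noteq> g t" if rt: "0 \<le> r" "r < t" for r t
  proof
    assume "g r = g t"
    obtain z where "r < z" "z < t" "g t - g r = (t - r) * D z" using MVT2[OF rt(2), of g D] der by blast
    then show False using \<open>g r = g t\<close> D0[of z] rt by simp
  qed
  have inj: "inj_on g {0..K}" for K
  proof (rule inj_onI)
    fix r t assume "r \<in> {0..K}" "t \<in> {0..K}" "g r = g t"
    then show "r = t" using ne[of r t] ne[of t r] by (cases r t rule: linorder_cases) auto
  qed
  \<comment> \<open>A point of the ray beyond \<open>s\<close> and at distance at least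
    \<open>R\<close> from the origin, where \<open>f\<close> is nonnegative.\<close>
  define K where "K = s + 1 + \<bar>R\<bar> / norm p"
  have K: "K > s" by (simp add: K_def add_pos_nonneg)
  have "norm (K *\<^sub>R p) = (s + 1) * norm p + \<bar>R\<bar>"
    using s p K by (simp add: K_def field_simps)
  then have "norm (K *\<^sub>R p) \<ge> R" using s by (smt (verit) mult_nonneg_nonneg norm_ge_zero)
  then have "g 0 < g K" using outer[of "K *\<^sub>R p"] neg by (simp add: g_def)
  then have "g 0 < g s"
    using continuous_inj_imp_mono[of 0 s K g] s K cg inj by auto
  then have "g 1 < g s"
    using continuous_inj_imp_mono[of 0 1 s g] s cg inj by auto
  then show ?thesis by (simp add: g_def)
qed

theorem theorem2:
  fixes \<phi> :: "real \<times> real \<Rightarrow> real" and U :: "(real \<times> real) set" and \<sigma> :: real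
  assumes "C1_plane \<phi>"
    and "strictly_star_shaped \<phi>"
    and "bounded U"
    and "\<sigma> = (SUP p\<in>U. dist p (0, 0))"
    and "\<And>p. p \<notin> U \<Longrightarrow> \<phi> p \<ge> 0"
    and "\<And>r. r > \<sigma> \<Longrightarrow> \<exists>p. dist p (0, 0) = r \<and> \<phi> p \<noteq> 0"
    and "\<phi> (0, 0) < 0"
  shows "(\<exists>!\<Gamma>. limit_cycle (planar_system \<phi>) \<Gamma>) \<and>
    (\<forall>\<Gamma>. limit_cycle (planar_system \<phi>) \<Gamma> \<longrightarrow>
       (\<forall>I \<gamma>. maximal_solution_on (planar_system \<phi>) I \<gamma> \<and> \<not> \<gamma> constant_on I \<longrightarrow>
              attracts \<Gamma> I \<gamma>))"
proof -
  obtain B where B: "B > 0" "\<And>p. p \<in> U \<Longrightarrow> norm p \<le> B"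
    using assms(3) bounded_pos by metis
  \<comment> \<open>The added 1 places the points strictly outside every ball needed to contain
    \<open>U\<close>.\<close>
  have outer: "\<phi> p \<ge> 0" if "norm p \<ge> B + 1" for p
    using B(2)[of p] assms(5)[of p] that by force
  have neg: "\<phi> 0 < 0" using assms(7) by (simp add: zero_prod_def)
  have cont: "continuous_on UNIV \<phi>"
    using has_derivative_continuous[OF C1_plane_has_derivative[OF assms(1)]]
    by (intro continuous_at_imp_continuous_on) blast
  then have "open {p. \<phi> p < 0}" by (intro open_Collect_less continuous_intros)
  then obtain \<rho> where \<rho>: "\<rho> > 0" "cball 0 \<rho> \<subseteq> {p. \<phi> p < 0}"
    using neg open_contains_cball[of "{p. \<phi> p < 0}"] by blast
  interpret star_damping \<phi> "B + 1" \<rho>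
  proof
    show "\<exists>L>0. \<forall>p\<in>cball 0 M. \<forall>q\<in>cball 0 M. \<bar>\<phi> p - \<phi> q\<bar> \<le> L * norm (p - q)" for M
      by (rule C1_plane_lipschitz) fact
    show "\<phi> p < \<phi> (s *\<^sub>R p)" if "p \<noteq> 0" "s > 1" for p s
      using star_shaped_radial_increasing[OF assms(1,2) outer neg that] .
    show "\<phi> p \<le> 0" if "norm p \<le> \<rho>" for p
      using \<rho>(2) that by (auto simp: subset_eq intro: less_imp_le)
  qed (use cont outer B(1) \<rho>(1) in auto)
  show ?thesis using unique_attracting_limit_cycle by blast
qed

end
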